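(* Let $r>0$, $\rho\in\mathbb R$, $\theta=\arctan(\rho/r)$, and let $p_{r,\theta}$ denote the generalized hyperbolic secant density $$p_{r,\theta}(\eta)=e^{\theta\eta+r\log\cos\theta}\,\frac{2^{r-2}}{\pi\Gamma(r)}\Big|\Gamma\Big(\frac r2+i\frac\eta2\Big)\Big|^2,\qquad\eta\in\mathbb R.$$ Define, for $x,y,\alpha\in\mathbb R$, $$q_\alpha(x,y)=\frac{p_{r,\theta}(x-\alpha)\,p_{r,\theta}(y+\alpha)}{Z(x+y)},\qquad Z(x+y)=\int_{\mathbb R}p_{r,\theta}(x-\alpha')\,p_{r,\theta}(y+\alpha')\,d\alpha'.$$ Consider the Markov jump process on $\mathbb R^{\mathbb T_N}$ with generator $$L^{\mathrm{Red}}f(\eta)=\frac12\sum_{\substack{x,y\in\mathbb T_N\\|x-y|=1}}\int_{\mathbb R}q_\alpha(\eta_x,\eta_y)\big[f(\eta-\alpha\delta_x+\alpha\delta_y)-f(\eta)\big]d\alpha .$$ Then: (i) $\int_{\mathbb R}q_\alpha(x,y)\,d\alpha=1$ for all $x,y\in\mathbb R$, and the detailed balance relation $q_\alpha(x,y)p_{r,\theta}(x)p_{r,\theta}(y)=q_\alpha(y+\alpha,x-\alpha)p_{r,\theta}(x-\alpha)p_{r,\theta}(y+\alpha)$ holds for all $x,y,\alpha\in\mathbb R$; consequently the product measure $\nu_\rho^{\mathrm{GHS}}$ on $\mathbb R^{\mathbb T_N}$ with common marginal density $p_{r,\theta}$ (which has mean $\rho$ and variance $\rho^2/r+r$) is invariant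 for the process. (ii) The first moment $\int_{\mathbb R}\alpha\,q_\alpha(x,y)\,d\alpha$ equals $(x-y)/2$, and the second moment $\int_{\mathbb R}\alpha^2q_\alpha(x,y)\,d\alpha$ is a polynomial of degree two in $(x,y)$; consequently the generator maps $\eta_x$ to a polynomial of degree at most one and $\eta_x\eta_{x+1}$ to a polynomial of degree at most two in the state variables.
   Context: $\mathbb T_N=\mathbb Z/N\mathbb Z$ is the discrete torus; the sum in $L^{\mathrm{Red}}$ is over ordered pairs of nearest neighbours. For $x\in\mathbb T_N$, $\delta_x$ is the configuration equal to $1$ at $x$ and $0$ elsewhere. The operator $L^{\mathrm{Red}}$ is applied to bounded measurable functions and to polynomials of degree at most two in $(\eta_x)_{x\in\mathbb T_N}$ through the displayed formula. A probability measure $\nu$ is invariant if it is preserved by the Markov semigroup (equivalently here $E_\nu[L^{\mathrm{Red}}f]=0$ for bounded measurable $f$). *)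

theory Defs
  imports "HOL-Probability.Probability"
begin

definition ghs_density :: "real \<Rightarrow> real \<Rightarrow> real \<Rightarrow> real" where
  "ghs_density r \<theta> \<eta> =
     exp (\<theta> * \<eta> + r * ln (cos \<theta>)) * (2 powr (r - 2) / (pi * Gamma r))
       * (cmod (Gamma (complex_of_real (r / 2) + \<i> * complex_of_real (\<eta> / 2))))\<^sup>2"

definition ghs_measure :: "real \<Rightarrow> real \<Rightarrow> real measure" where
  "ghs_measure r \<theta> = density lborel (\<lambda>\<eta>. ennreal (ghs_density r \<theta> \<eta>))"

text \<open>The normalisation \<open>Z(x + y)\<close> is given by a formula in \<open>x\<close> and \<open>y\<close>; the lemma
  \<open>ghs_Z_sum\<close> justifies writing it as a function of the sum.\<close>

definition ghs_Z :: "real \<Rightarrow> real \<Rightarrow> real \<Rightarrow> real \<Rightarrow> real" where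
  "ghs_Z r \<theta> x y = (LINT \<alpha>|lborel. ghs_density r \<theta> (x - \<alpha>) * ghs_density r \<theta> (y + \<alpha>))"

lemma ghs_Z_sum:
  assumes "x + y = x' + y'"
  shows "ghs_Z r \<theta> x y = ghs_Z r \<theta> x' y'"
proof -
  have y': "y' = y + (x - x')"
    using assms by simp
  show ?thesis
    unfolding ghs_Z_def y'
    by (subst lborel_integral_real_affine[where c = 1 and t = "x - x'"])
      (simp_all add: algebra_simps)
qed

definition ghs_q :: "real \<Rightarrow> real \<Rightarrow> real \<Rightarrow> real \<Rightarrow> real \<Rightarrow> real" where
  "ghs_q r \<theta> \<alpha> x y =
     ghs_density r \<theta> (x - \<alpha>) * ghs_density r \<theta> (y + \<alpha>) / ghs_Z r \<theta> x y"

text \<open>The torus \<open>\<int>/N\<int>\<close> is represented by the residues \<open>{..<N}\<close>, and configurations are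
  functions that are \<open>undefined\<close> outside \<open>{..<N}\<close>.\<close>

definition config_space :: "nat \<Rightarrow> (nat \<Rightarrow> real) measure" where
  "config_space N = (\<Pi>\<^sub>M x\<in>{..<N}. borel)"

text \<open>Ordered pairs at torus distance one. The condition \<open>x \<noteq> y\<close> only matters for
  \<open>N = 1\<close>, where there are no such pairs; for \<open>N = 2\<close> they are \<open>(0, 1)\<close> and \<open>(1, 0)\<close>.\<close>

definition neighbours :: "nat \<Rightarrow> (nat \<times> nat) set" where
  "neighbours N = {(x, y). x < N \<and> y < N \<and> x \<noteq> y \<and>
     (y = (x + 1) mod N \<or> x = (y + 1) mod N)}"

definition delta :: "nat \<Rightarrow> nat \<Rightarrow> real" where
  "delta x z = (if z = x then 1 else 0)"

definition transfer :: "nat \<Rightarrow> nat \<Rightarrow> real \<Rightarrow> (nat \<Rightarrow> real) \<Rightarrow> nat \<Rightarrow> real" where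
  "transfer x y \<alpha> \<eta> = (\<lambda>z. \<eta> z - \<alpha> * delta x z + \<alpha> * delta y z)"

definition L_Red ::
    "real \<Rightarrow> real \<Rightarrow> nat \<Rightarrow> ((nat \<Rightarrow> real) \<Rightarrow> real) \<Rightarrow> (nat \<Rightarrow> real) \<Rightarrow> real" where
  "L_Red r \<theta> N f \<eta> =
     1 / 2 * (\<Sum>(x, y)\<in>neighbours N.
       LINT \<alpha>|lborel. ghs_q r \<theta> \<alpha> (\<eta> x) (\<eta> y) * (f (transfer x y \<alpha> \<eta>) - f \<eta>))"

text \<open>For unbounded \<open>f\<close> the integrals in \<open>L_Red\<close> need not exist; this says that they do.\<close>

definition L_Red_defined :: "real \<Rightarrow> real \<Rightarrow> nat \<Rightarrow> ((nat \<Rightarrow> real) \<Rightarrow> real) \<Rightarrow> bool" where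
  "L_Red_defined r \<theta> N f \<longleftrightarrow>
     (\<forall>\<eta>\<in>space (config_space N). \<forall>(x, y)\<in>neighbours N.
       integrable lborel
         (\<lambda>\<alpha>. ghs_q r \<theta> \<alpha> (\<eta> x) (\<eta> y) * (f (transfer x y \<alpha> \<eta>) - f \<eta>)))"

definition bounded_measurable :: "'a measure \<Rightarrow> ('a \<Rightarrow> real) set" where
  "bounded_measurable M = {f \<in> borel_measurable M. bounded (f ` space M)}"

text \<open>The jump rates are bounded (each ordered pair of neighbours rings at rate \<open>1/2\<close>), so
  \<open>L_Red\<close> is a bounded operator on the bounded measurable functions and the Markov semigroup
  of the jump process is the exponential \<open>e\<^sup>t\<^sup>L\<close>.\<close>

definition exp_semigroup :: "(('a \<Rightarrow> real) \<Rightarrow> 'a \<Rightarrow> real) \<Rightarrow> real \<Rightarrow> ('a \<Rightarrow> real) \<Rightarrow> 'a \<Rightarrow> real" where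
  "exp_semigroup L t f \<eta> = (\<Sum>k. t ^ k / fact k * (L ^^ k) f \<eta>)"

definition invariant_measure :: "(('a \<Rightarrow> real) \<Rightarrow> 'a \<Rightarrow> real) \<Rightarrow> 'a measure \<Rightarrow> bool" where
  "invariant_measure L \<nu> \<longleftrightarrow> prob_space \<nu> \<and>
     (\<forall>t\<ge>0. \<forall>f\<in>bounded_measurable \<nu>.
        integrable \<nu> (exp_semigroup L t f) \<and>
        (LINT \<eta>|\<nu>. exp_semigroup L t f \<eta>) = (LINT \<eta>|\<nu>. f \<eta>))"

definition nu_GHS :: "real \<Rightarrow> real \<Rightarrow> nat \<Rightarrow> (nat \<Rightarrow> real) measure" where
  "nu_GHS r \<theta> N = (\<Pi>\<^sub>M x\<in>{..<N}. ghs_measure r \<theta>)"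

text \<open>\<open>g\<close> agrees on configurations with a real polynomial in \<open>\<eta>\<^sub>0, \<dots>, \<eta>\<^sub>N\<^sub>-\<^sub>1\<close> of
  total degree at most \<open>d\<close>; \<open>m\<close> ranges over the exponent vectors.\<close>

definition polynomial_deg_le :: "nat \<Rightarrow> nat \<Rightarrow> ((nat \<Rightarrow> real) \<Rightarrow> real) \<Rightarrow> bool" where
  "polynomial_deg_le N d g \<longleftrightarrow>
     (\<exists>c. \<forall>\<eta>\<in>space (config_space N).
        g \<eta> = (\<Sum>m | m \<in> {..<N} \<rightarrow>\<^sub>E {..d} \<and> (\<Sum>z<N. m z) \<le> d. c m * (\<Prod>z<N. \<eta> z ^ m z)))"

end

theory Submission
  imports Defs "HOL-Complex_Analysis.Complex_Analysis"
begin

text \<open>Up to normalisation the density is \<open>exp (\<theta> u) * w\<^sub>r u\<close> with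
  \<open>w\<^sub>r u = \<bar>\<Gamma>(r/2 + \<i> u/2)\<bar>\<^sup>2\<close>, and the tilt cancels in \<open>q\<close>. On the lines \<open>Im z = \<plusminus>1\<close> the analytic
  continuation of \<open>w\<^sub>r\<^sub>+\<^sub>1\<close> equals \<open>(r \<mp> \<i> u)/2 * w\<^sub>r u\<close>, by the functional equation of \<open>\<Gamma>\<close>. Hence
  shifting the contour in integrals against \<open>w\<^sub>r\<^sub>+\<^sub>1\<close> yields linear relations between moments against
  \<open>w\<^sub>r\<close>: the integrand \<open>exp (\<theta> z) w\<^sub>r\<^sub>+\<^sub>1 z\<close> gives the mean, \<open>z exp (\<theta> z) w\<^sub>r\<^sub>+\<^sub>1 z\<close> the variance, and
  \<open>(z - s/2) w\<^sub>r\<^sub>+\<^sub>1 z w\<^sub>r\<^sub>+\<^sub>1 (s - z)\<close> the second moment of \<open>q\<close>. The first relation is also the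
  differential equation \<open>M' = r tan \<theta> M\<close> for the moment generating function of \<open>w\<^sub>r\<close>, whose initial
  value comes from Plancherel's theorem, because \<open>y \<mapsto> \<Gamma>(a + \<i> y)\<close> is the Fourier transform of
  \<open>x \<mapsto> exp (a x - exp x)\<close>. Invariance holds for every ordered pair of sites separately, by detailed
  balance and Fubini's theorem.\<close>

section \<open>Decay of the Gamma weight\<close>

lemma nonpos_Ints_Re_pos: "0 < Re z \<Longrightarrow> z \<notin> \<int>\<^sub>\<le>\<^sub>0"
  by (auto elim!: nonpos_Ints_cases)

text \<open>The weight of parameter r continues only to the strip of half-width r, with poles at i r
  and -i r, so for r \<le> 1 a contour at height 1 is out of its reach. This is why the contour is
  moved against the weight of parameter r + 1: its strip contains both lines, and each line lands on
  the weight of parameter r times a linear factor. The test function is chosen with conjugate values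
  on the two lines, so that the shift becomes one real equation. Contour shifts, moments and
  differentiation under the integral all rest on decay of the weight at every rate below pi/2, which
  matches the tilt because \<theta> is an arctangent. The normalisation of q never has to be
  evaluated: all its moments come out as multiples of the same convolution integral, which only has
  to be positive.\<close>

text \<open>In Euler's limit the factors |s + k + i y| / (s + k) = sqrt (1 + y^2 / (s + k)^2) stand
  in the denominator and decrease in s, so |Gamma (s + i y)| / Gamma s increases. It transfers
  bounds from a large parameter to every smaller one.\<close>

lemma norm_Gamma_mono:
  assumes "0 < s" "s \<le> s'"
  shows "cmod (Gamma (Complex s y)) * Gamma s' \<le> cmod (Gamma (Complex s' y)) * Gamma s"
proof (rule LIMSEQ_le)
  show "(\<lambda>n. cmod (Gamma_series (Complex s y) n) * Gamma_series s' n)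
      \<longlonglongrightarrow> cmod (Gamma (Complex s y)) * Gamma s'"
    by (intro tendsto_intros)
  show "(\<lambda>n. cmod (Gamma_series (Complex s' y) n) * Gamma_series s n)
      \<longlonglongrightarrow> cmod (Gamma (Complex s' y)) * Gamma s"
    by (intro tendsto_intros)
  have step: "cmod (pochhammer (Complex s' y) n) * pochhammer s n
      \<le> cmod (pochhammer (Complex s y) n) * pochhammer s' n" for n
  proof -
    have "cmod (Complex s' y + of_nat k) * (s + of_nat k)
        \<le> cmod (Complex s y + of_nat k) * (s' + of_nat k)" for k
    proof (rule power2_le_imp_le)
      have *: "(cmod (Complex t y + of_nat k))\<^sup>2 = (t + real k)\<^sup>2 + y\<^sup>2" for t
        by (simp add: cmod_power2)
      have "y\<^sup>2 * (s + real k)\<^sup>2 \<le> y\<^sup>2 * (s' + real k)\<^sup>2"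
        using assms by (intro mult_left_mono power_mono) auto
      then show "(cmod (Complex s' y + of_nat k) * (s + of_nat k))\<^sup>2
          \<le> (cmod (Complex s y + of_nat k) * (s' + of_nat k))\<^sup>2"
        unfolding power_mult_distrib * by (simp add: algebra_simps)
    qed (use assms in simp)
    then show ?thesis
      unfolding pochhammer_prod prod_norm[symmetric] prod.distrib[symmetric]
      using assms by (intro prod_mono) auto
  qed
  have "cmod (Gamma_series (Complex s y) n) * Gamma_series s' n
      \<le> cmod (Gamma_series (Complex s' y) n) * Gamma_series s n" for n
  proof -
    have nz: "pochhammer (Complex t y) (Suc n) \<noteq> 0" if "0 < t" for t
    proof
      assume "pochhammer (Complex t y) (Suc n) = 0"
      then obtain k where "Complex t y = - of_nat k" unfolding pochhammer_eq_0_iff by blast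
      then have "t = - real k" by (simp add: complex_eq_iff)
      with that show False by simp
    qed
    have pos: "0 < pochhammer t (Suc n)" if "0 < t" for t :: real
      using that by (rule pochhammer_pos)
    have "0 < s'" using assms by simp
    have e: "cmod (exp (Complex t y * complex_of_real (ln (real n)))) = exp (t * ln (real n))" for t
      by simp
    have "1 / (cmod (pochhammer (Complex s y) (Suc n)) * pochhammer s' (Suc n))
       \<le> 1 / (cmod (pochhammer (Complex s' y) (Suc n)) * pochhammer s (Suc n))"
      using step[of "Suc n"] nz[OF \<open>0 < s'\<close>] pos[OF \<open>0 < s\<close>]
      by (intro divide_left_mono mult_pos_pos) (use nz[OF \<open>0 < s\<close>] pos[OF \<open>0 < s'\<close>] in auto)
    then have "(fact n * fact n * exp (s * ln (real n)) * exp (s' * ln (real n))) *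
       (1 / (cmod (pochhammer (Complex s y) (Suc n)) * pochhammer s' (Suc n)))
       \<le> (fact n * fact n * exp (s * ln (real n)) * exp (s' * ln (real n))) *
        (1 / (cmod (pochhammer (Complex s' y) (Suc n)) * pochhammer s (Suc n)))"
      by (intro mult_left_mono) auto
    then show ?thesis
      unfolding Gamma_series_def norm_mult norm_divide
      using e by (simp add: mult_ac)
  qed
  then show "\<exists>N. \<forall>n\<ge>N. cmod (Gamma_series (Complex s y) n) * Gamma_series s' n
      \<le> cmod (Gamma_series (Complex s' y) n) * Gamma_series s n"
    by blast
qed

text \<open>On the line Re z = 1/2 one has 1 - z = cnj z, so the reflection formula evaluates the
  squared modulus exactly; the sine at pi/2 + i pi y is cosh (pi y).\<close>

lemma norm_Gamma_half_squared:
  "(cmod (Gamma (Complex (1/2) y)))\<^sup>2 = pi / cosh (pi * y)"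
proof -
  have c: "1 - Complex (1/2) y = cnj (Complex (1/2) y)"
    by (simp add: complex_eq_iff)
  have "complex_of_real ((cmod (Gamma (Complex (1/2) y)))\<^sup>2)
      = Gamma (Complex (1/2) y) * Gamma (1 - Complex (1/2) y)"
    unfolding c cnj_Gamma[symmetric] complex_norm_square ..
  also have "\<dots> = of_real pi / sin (of_real pi * Complex (1/2) y)"
    by (rule Gamma_reflection_complex)
  also have "of_real pi * Complex (1/2) y = of_real (pi / 2) - (- \<i> * of_real (pi * y))"
    by (simp add: complex_eq_iff)
  also have "sin \<dots> = cos (- \<i> * of_real (pi * y))"
    by (simp only: cos_sin_eq of_real_divide of_real_numeral)
  also have "\<dots> = of_real (cosh (pi * y))"
    by (simp add: cos_conv_cosh cosh_def scaleR_conv_of_real flip: exp_of_real)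
  finally show ?thesis
    by (simp add: of_real_eq_iff[where 'a=complex, symmetric] del: of_real_eq_iff)
qed

definition gamma_weight :: "real \<Rightarrow> real \<Rightarrow> real" where
  "gamma_weight r u = (cmod (Gamma (Complex (r / 2) (u / 2))))\<^sup>2"

text \<open>Absorbs a quadratic factor at the cost of an arbitrarily small loss \<open>d\<close> in
  an exponential rate; the constant comes from the quadratic Taylor term of the exponential.\<close>

lemma square_le_exp:
  fixes a d :: real
  assumes "0 \<le> a" "0 < d"
  obtains C where "0 < C" "\<And>u. a + u\<^sup>2 \<le> C * exp (d * \<bar>u\<bar>)"
proof
  show "0 < a + 2 / d\<^sup>2" using assms by (simp add: add_nonneg_pos)
  fix u :: real
  have e: "1 + d * \<bar>u\<bar> + (d * \<bar>u\<bar>)\<^sup>2 / 2 \<le> exp (d * \<bar>u\<bar>)"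
    using assms by (intro exp_lower_Taylor_quadratic) auto
  have "(d * \<bar>u\<bar>)\<^sup>2 / 2 \<le> exp (d * \<bar>u\<bar>)"
    using e assms by (smt (verit) mult_nonneg_nonneg abs_ge_zero)
  then have "2 / d\<^sup>2 * ((d * \<bar>u\<bar>)\<^sup>2 / 2) \<le> 2 / d\<^sup>2 * exp (d * \<bar>u\<bar>)"
    by (intro mult_left_mono) auto
  moreover have "2 / d\<^sup>2 * ((d * \<bar>u\<bar>)\<^sup>2 / 2) = u\<^sup>2"
    using assms by (simp add: field_simps)
  moreover have "a * 1 \<le> a * exp (d * \<bar>u\<bar>)"
    using assms by (intro mult_left_mono) auto
  ultimately show "a + u\<^sup>2 \<le> (a + 2 / d\<^sup>2) * exp (d * \<bar>u\<bar>)"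
    by (simp add: algebra_simps)
qed

lemma gamma_weight_add_2:
  assumes "0 < r"
  shows "gamma_weight (r + 2) u = (r\<^sup>2 + u\<^sup>2) / 4 * gamma_weight r u"
proof -
  have "Complex ((r + 2) / 2) (u / 2) = Complex (r / 2) (u / 2) + 1"
    by (simp add: complex_eq_iff)
  moreover have "Complex (r / 2) (u / 2) \<notin> \<int>\<^sub>\<le>\<^sub>0"
    using assms by (intro nonpos_Ints_Re_pos) simp
  ultimately show ?thesis
    by (simp add: gamma_weight_def Gamma_plus1 norm_mult power_mult_distrib cmod_power2
        power_divide add_divide_distrib)
qed

text \<open>The base case is the closed form at r = 1. Each step multiplies the weight by a
  quadratic polynomial, so the rate \<open>k\<close> is kept general: the induction hypothesis is
  used at a rate strictly between \<open>k\<close> and pi/2.\<close>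

lemma gamma_weight_odd_decay:
  assumes "k < pi / 2"
  shows "\<exists>C>0. \<forall>u. gamma_weight (2 * real m + 1) u \<le> C * exp (- k * \<bar>u\<bar>)"
  using assms
proof (induction m arbitrary: k)
  case 0
  have "gamma_weight 1 u \<le> (2 * pi) * exp (- k * \<bar>u\<bar>)" for u
  proof -
    have "gamma_weight 1 u = pi / cosh (pi * (u / 2))"
      by (simp add: gamma_weight_def norm_Gamma_half_squared)
    also have "\<dots> \<le> pi / (exp (k * \<bar>u\<bar>) / 2)"
    proof (intro divide_left_mono)
      have "exp (k * \<bar>u\<bar>) \<le> exp (\<bar>pi * (u / 2)\<bar>)"
        using 0 mult_right_mono[of k "pi/2" "\<bar>u\<bar>"] by (simp add: abs_mult)
      also have "\<dots> / 2 \<le> cosh \<bar>pi * (u / 2)\<bar>"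
        by (simp add: cosh_def)
      finally show "exp (k * \<bar>u\<bar>) / 2 \<le> cosh (pi * (u / 2))" by (simp only: cosh_real_abs)
    qed auto
    also have "\<dots> = (2 * pi) * exp (- k * \<bar>u\<bar>)"
      by (simp add: exp_minus field_simps)
    finally show ?thesis .
  qed
  then show ?case by (intro exI[of _ "2 * pi"]) auto
next
  case (Suc m)
  \<comment> \<open>Half of the gap to pi/2: at rate \<open>k + d\<close> the induction hypothesis
    leaves exp (- d |u|) to absorb the quadratic factor.\<close>
  define d where "d = (pi / 2 - k) / 2"
  have d: "0 < d" "k + d < pi / 2" using Suc.prems by (simp_all add: d_def field_simps)
  obtain C where C: "0 < C" "\<And>u. gamma_weight (2 * real m + 1) u \<le> C * exp (- (k + d) * \<bar>u\<bar>)"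
    using Suc.IH[OF d(2)] by blast
  obtain D where D: "0 < D" "\<And>u. (2 * real m + 1)\<^sup>2 + u\<^sup>2 \<le> D * exp (d * \<bar>u\<bar>)"
    using square_le_exp[OF _ d(1), of "(2 * real m + 1)\<^sup>2"] by auto
  show ?case
  proof (intro exI[of _ "D / 4 * C"] conjI allI)
    fix u
    have "gamma_weight (2 * real (Suc m) + 1) u
        = ((2 * real m + 1)\<^sup>2 + u\<^sup>2) / 4 * gamma_weight (2 * real m + 1) u"
      using gamma_weight_add_2[of "2 * real m + 1" u] by (simp add: add_ac)
    also have "\<dots> \<le> (D * exp (d * \<bar>u\<bar>)) / 4 * (C * exp (- (k + d) * \<bar>u\<bar>))"
      using C(2)[of u] D(2)[of u] by (intro mult_mono divide_right_mono) (auto simp: gamma_weight_def \<open>0 < D\<close>[THEN less_imp_le])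
    also have "\<dots> = D / 4 * C * (exp (d * \<bar>u\<bar>) * exp (- (k + d) * \<bar>u\<bar>))"
      by simp
    also have "exp (d * \<bar>u\<bar>) * exp (- (k + d) * \<bar>u\<bar>) = exp (- k * \<bar>u\<bar>)"
      unfolding exp_add[symmetric] by (simp add: algebra_simps)
    finally show "gamma_weight (2 * real (Suc m) + 1) u \<le> D / 4 * C * exp (- k * \<bar>u\<bar>)" .
  qed (use C D in auto)
qed

text \<open>Comparison with an odd integer parameter r' above r, through
  \<open>norm_Gamma_mono\<close> at the real parts r/2 and r'/2.\<close>

lemma gamma_weight_decay:
  assumes "0 < r" "k < pi / 2"
  obtains C where "0 < C" "\<And>u. gamma_weight r u \<le> C * exp (- k * \<bar>u\<bar>)"
proof -
  obtain m :: nat where m: "r \<le> real m" using real_arch_simple by blast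
  define r' where "r' = 2 * real m + 1"
  have r': "r \<le> r'" "0 < r'" using m assms by (simp_all add: r'_def)
  obtain C where C: "0 < C" "\<And>u. gamma_weight r' u \<le> C * exp (- k * \<bar>u\<bar>)"
    using gamma_weight_odd_decay[OF assms(2), of m] unfolding r'_def by blast
  define D where "D = (Gamma (r / 2) / Gamma (r' / 2))\<^sup>2"
  have G: "0 < Gamma (r / 2)" "0 < Gamma (r' / 2)" using assms r' by (auto intro: Gamma_real_pos)
  show ?thesis
  proof
    show "0 < D * C" using G C by (simp add: D_def)
    fix u
    have "cmod (Gamma (Complex (r/2) (u/2))) \<le> Gamma (r / 2) / Gamma (r' / 2) * cmod (Gamma (Complex (r'/2) (u/2)))"
      using norm_Gamma_mono[of "r/2" "r'/2" "u/2"] assms r' G by (simp add: field_simps)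
    then have "gamma_weight r u \<le> D * gamma_weight r' u"
      unfolding gamma_weight_def D_def power_mult_distrib[symmetric] by (intro power_mono) auto
    also have "\<dots> \<le> D * (C * exp (- k * \<bar>u\<bar>))"
      using C(2)[of u] by (intro mult_left_mono) (simp_all add: D_def)
    finally show "gamma_weight r u \<le> D * C * exp (- k * \<bar>u\<bar>)" by simp
  qed
qed

lemma integrable_exp_abs:
  fixes k :: real
  assumes "0 < k"
  shows "integrable lborel (\<lambda>x. exp (- k * \<bar>x\<bar>))"
proof -
  obtain C where C: "0 < C" "\<And>u. 1 + u\<^sup>2 \<le> C * exp (k * \<bar>u\<bar>)"
    using square_le_exp[of 1 k] assms by auto
  have "integrable lborel (\<lambda>x::real. C * inverse (1 + x\<^sup>2))"
    using integrable_inverse_1_plus_square by (simp add: set_integrable_def)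
  then show ?thesis
  proof (rule Bochner_Integration.integrable_bound)
    show "AE x in lborel. norm (exp (- k * \<bar>x\<bar>)) \<le> norm (C * inverse (1 + x\<^sup>2))"
    proof (rule AE_I2)
      fix x :: real
      have "0 < 1 + x\<^sup>2" by (simp add: add_pos_nonneg)
      then show "norm (exp (- k * \<bar>x\<bar>)) \<le> norm (C * inverse (1 + x\<^sup>2))"
        using C(1) C(2)[of x] by (simp add: exp_minus field_simps)
    qed
  qed measurable
qed

section \<open>Plancherel's theorem and the total mass\<close>

text \<open>Multiplying by a Gaussian of width \<open>n\<close> makes Fubini applicable; the Fourier transform of
  that Gaussian is an approximate identity as \<open>n\<close> tends to infinity.\<close>

lemma Plancherel:
  fixes h :: "real \<Rightarrow> real" and H :: "real \<Rightarrow> complex"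
  assumes cont: "continuous_on UNIV h" and h0: "\<And>x. 0 \<le> h x" and hB: "\<And>x. h x \<le> B"
    and int: "integrable lborel h"
    and H: "\<And>y. H y = (CLINT x|lborel. of_real (h x) * iexp (y * x))"
    and int_H: "integrable lborel (\<lambda>y. (cmod (H y))\<^sup>2)"
  shows "(LINT y|lborel. (cmod (H y))\<^sup>2) = 2 * pi * (LINT x|lborel. (h x)\<^sup>2)"
proof -
  let ?N = std_normal_distribution
  interpret N: real_distribution ?N by (rule real_dist_normal_dist)
  interpret P: pair_sigma_finite ?N lborel ..
  have [measurable]: "h \<in> borel_measurable borel"
    using cont by (rule borel_measurable_continuous_onI)
  have [measurable]: "H \<in> borel_measurable borel"
    unfolding H[abs_def] by measurable
  have [measurable]: "cnj \<in> borel_measurable borel"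
    by (intro borel_measurable_continuous_onI continuous_intros)
  define I where "I = (LINT x|lborel. h x)"
  have I0: "0 \<le> I" unfolding I_def using h0 by (intro Bochner_Integration.integral_nonneg) auto
  have HI: "cmod (H y) \<le> I" for y
  proof -
    have "cmod (H y) \<le> (LINT x|lborel. cmod (of_real (h x) * iexp (y * x)))"
      unfolding H by (rule integral_norm_bound)
    also have "\<dots> = I" unfolding I_def using h0 by (simp add: norm_mult)
    finally show ?thesis .
  qed
  \<comment> \<open>Once \<open>H * cnj H\<close> is expanded into two Fourier integrals, the
    z-average of \<open>iexp (c * z * (x - x'))\<close> is the characteristic function of the
    standard normal law, hence a Gaussian in c (x - x'). The normal law is finite, which makes both
    uses of Fubini legitimate.\<close>
  have gauss: "(LINT z|?N. (cmod (H (c * z)))\<^sup>2)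
      = (LINT x|lborel. h x * (LINT x'|lborel. h x' * exp (- (c * (x - x'))\<^sup>2 / 2)))" for c
  proof -
    have inner: "(CLINT z|?N. iexp (c * z * x) * cnj (H (c * z)))
        = (CLINT x'|lborel. of_real (h x' * exp (- (c * (x - x'))\<^sup>2 / 2)))" for x
    proof -
      let ?f = "\<lambda>z x'. of_real (h x') * iexp (c * z * (x - x'))"
      have "integrable (?N \<Otimes>\<^sub>M lborel) (case_prod ?f)"
      proof (rule P.Fubini_integrable)
        show "AE z in ?N. integrable lborel (\<lambda>x'. case_prod ?f (z, x'))"
          by (intro AE_I2 Bochner_Integration.integrable_bound[OF int]) (auto simp: norm_mult)
      qed (simp_all add: norm_mult)
      note F = P.Fubini_integral[OF this]
      have "(CLINT z|?N. iexp (c * z * x) * cnj (H (c * z))) = (CLINT z|?N. (CLINT x'|lborel. ?f z x'))"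
      proof (intro Bochner_Integration.integral_cong refl)
        fix z
        have "cnj (H (c * z)) = (CLINT x'|lborel. of_real (h x') * iexp (- (c * z * x')))"
          unfolding H Bochner_Integration.integral_cnj[symmetric]
          by (intro Bochner_Integration.integral_cong refl) (simp add: exp_cnj)
        then have "iexp (c * z * x) * cnj (H (c * z))
            = (CLINT x'|lborel. iexp (c * z * x) * (of_real (h x') * iexp (- (c * z * x'))))"
          by simp
        also have "\<dots> = (CLINT x'|lborel. ?f z x')"
          by (intro Bochner_Integration.integral_cong refl)
             (simp add: exp_add[symmetric] algebra_simps)
        finally show "iexp (c * z * x) * cnj (H (c * z)) = (CLINT x'|lborel. ?f z x')" .
      qed
      also have "\<dots> = (CLINT x'|lborel. (CLINT z|?N. ?f z x'))" using F by simp
      also have "\<dots> = (CLINT x'|lborel. of_real (h x') * char ?N (c * (x - x')))"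
        unfolding char_def by (simp add: mult_ac)
      finally show ?thesis by (simp add: char_std_normal_distribution)
    qed
    let ?g = "\<lambda>z x. of_real (h x) * (iexp (c * z * x) * cnj (H (c * z)))"
    have "integrable (?N \<Otimes>\<^sub>M lborel) (case_prod ?g)"
    proof (rule P.Fubini_integrable)
      have "integrable ?N (\<lambda>z. I * cmod (H (c * z)))"
        by (rule N.integrable_const_bound[where B = "I * I"])
           (use HI I0 in \<open>auto intro!: mult_left_mono simp: abs_mult\<close>)
      moreover have "(LINT x|lborel. norm (case_prod ?g (z, x))) = I * cmod (H (c * z))" for z
        unfolding I_def using h0 by (simp add: norm_mult)
      ultimately show "integrable ?N (\<lambda>z. LINT x|lborel. norm (case_prod ?g (z, x)))" by simp
      show "AE z in ?N. integrable lborel (\<lambda>x. case_prod ?g (z, x))"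
      proof (intro AE_I2)
        fix z
        have "integrable lborel (\<lambda>x. h x * cmod (H (c * z)))" using int by simp
        then show "integrable lborel (\<lambda>x. case_prod ?g (z, x))"
          by (rule Bochner_Integration.integrable_bound) (auto simp: norm_mult)
      qed
    qed simp
    note F = P.Fubini_integral[OF this]
    have "complex_of_real (LINT z|?N. (cmod (H (c * z)))\<^sup>2) = (CLINT z|?N. H (c * z) * cnj (H (c * z)))"
      by (simp add: complex_norm_square[symmetric] del: of_real_power)
    also have "\<dots> = (CLINT z|?N. (CLINT x|lborel. ?g z x))"
    proof (intro Bochner_Integration.integral_cong refl)
      fix z
      have "H (c * z) * cnj (H (c * z))
          = (CLINT x|lborel. of_real (h x) * iexp (c * z * x) * cnj (H (c * z)))"
        by (subst H) simp
      then show "H (c * z) * cnj (H (c * z)) = (CLINT x|lborel. ?g z x)"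
        by (simp add: mult.assoc)
    qed
    also have "\<dots> = (CLINT x|lborel. of_real (h x) * (CLINT z|?N. iexp (c * z * x) * cnj (H (c * z))))"
      using F by simp
    also have "\<dots> = complex_of_real (LINT x|lborel. h x * (LINT x'|lborel. h x' * exp (- (c * (x - x'))\<^sup>2 / 2)))"
      unfolding inner integral_complex_of_real of_real_mult[symmetric] ..
    finally show ?thesis by (simp only: of_real_eq_iff)
  qed
  have N_int: "(LINT z|?N. f z) = (LINT z|lborel. exp (- z\<^sup>2 / 2) * f z) / sqrt (2 * pi)"
    if [measurable]: "f \<in> borel_measurable borel" for f :: "real \<Rightarrow> real"
  proof -
    have "(LINT z|?N. f z) = (LINT z|lborel. std_normal_density z * f z)"
      by (subst integral_density) auto
    also have "\<dots> = (LINT z|lborel. exp (- z\<^sup>2 / 2) * f z / sqrt (2 * pi))"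
      by (intro Bochner_Integration.integral_cong refl) (simp add: std_normal_density_def)
    finally show ?thesis by simp
  qed
  \<comment> \<open>Substituting y = c z on the left and x' = x + s / c on the right gives damping
    of width c against averaging of width 1 / c. The two normalisations sqrt (2 pi) multiply to the
    constant 2 pi.\<close>
  have regularised: "(LINT y|lborel. exp (- (y / c)\<^sup>2 / 2) * (cmod (H y))\<^sup>2)
      = 2 * pi * (LINT x|lborel. h x * (LINT s|?N. h (x + s / c)))" if c: "0 < c" for c
  proof -
    have inner: "(LINT x'|lborel. h x' * exp (- (c * (x - x'))\<^sup>2 / 2))
        = sqrt (2 * pi) / c * (LINT s|?N. h (x + s / c))" for x
    proof -
      have "(LINT x'|lborel. h x' * exp (- (c * (x - x'))\<^sup>2 / 2))
          = (LINT s|lborel. h (x + s / c) * exp (- s\<^sup>2 / 2)) / c"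
        using c by (subst lborel_integral_real_affine[where c = "1 / c" and t = x]) auto
      then show ?thesis by (subst N_int) (auto simp: mult.commute)
    qed
    have "(LINT y|lborel. exp (- (y / c)\<^sup>2 / 2) * (cmod (H y))\<^sup>2)
        = c * (LINT z|lborel. exp (- z\<^sup>2 / 2) * (cmod (H (c * z)))\<^sup>2)"
      using c by (subst lborel_integral_real_affine[where c = c and t = 0]) auto
    also have "\<dots> = c * sqrt (2 * pi) * (LINT z|?N. (cmod (H (c * z)))\<^sup>2)"
      by (subst N_int) auto
    also have "\<dots> = c * sqrt (2 * pi)
        * (LINT x|lborel. h x * (LINT x'|lborel. h x' * exp (- (c * (x - x'))\<^sup>2 / 2)))"
      unfolding gauss ..
    also have "\<dots> = c * sqrt (2 * pi)
        * (LINT x|lborel. h x * (sqrt (2 * pi) / c * (LINT s|?N. h (x + s / c))))"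
      unfolding inner ..
    also have "(LINT x|lborel. h x * (sqrt (2 * pi) / c * (LINT s|?N. h (x + s / c))))
        = sqrt (2 * pi) / c * (LINT x|lborel. h x * (LINT s|?N. h (x + s / c)))"
      unfolding integral_mult_right_zero[symmetric]
      by (intro Bochner_Integration.integral_cong refl) (simp only: mult.left_commute)
    also have "c * sqrt (2 * pi) * (sqrt (2 * pi) / c * (LINT x|lborel. h x * (LINT s|?N. h (x + s / c))))
        = (sqrt (2 * pi) * sqrt (2 * pi)) * (LINT x|lborel. h x * (LINT s|?N. h (x + s / c)))"
      using c by (simp del: real_sqrt_mult_self)
    also have "sqrt (2 * pi) * sqrt (2 * pi) = 2 * pi" by simp
    finally show ?thesis .
  qed
  let ?L = "\<lambda>n::nat. LINT y|lborel. exp (- (y / Suc n)\<^sup>2 / 2) * (cmod (H y))\<^sup>2"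
  have inv: "(\<lambda>n. a / real (Suc n)) \<longlonglongrightarrow> 0" for a :: real
    using LIMSEQ_Suc[OF lim_const_over_n[of a]] by simp
  have "?L \<longlonglongrightarrow> (LINT y|lborel. (cmod (H y))\<^sup>2)"
  proof (rule integral_dominated_convergence[where w = "\<lambda>y. (cmod (H y))\<^sup>2"])
    show "AE y in lborel. (\<lambda>n. exp (- (y / Suc n)\<^sup>2 / 2) * (cmod (H y))\<^sup>2) \<longlonglongrightarrow> (cmod (H y))\<^sup>2"
    proof (rule AE_I2)
      fix y
      have "(\<lambda>n. exp (- (y / Suc n)\<^sup>2 / 2) * (cmod (H y))\<^sup>2) \<longlonglongrightarrow> exp (- 0\<^sup>2 / 2) * (cmod (H y))\<^sup>2"
        by (intro tendsto_intros inv) auto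
      then show "(\<lambda>n. exp (- (y / Suc n)\<^sup>2 / 2) * (cmod (H y))\<^sup>2) \<longlonglongrightarrow> (cmod (H y))\<^sup>2" by simp
    qed
    show "AE y in lborel. norm (exp (- (y / Suc n)\<^sup>2 / 2) * (cmod (H y))\<^sup>2) \<le> (cmod (H y))\<^sup>2" for n
      by (rule AE_I2) (auto simp: abs_mult intro!: mult_left_le_one_le)
  qed (use int_H in auto)
  moreover have "?L \<longlonglongrightarrow> 2 * pi * (LINT x|lborel. (h x)\<^sup>2)"
  proof -
    have inner: "(\<lambda>n. LINT s|?N. h (x + s / Suc n)) \<longlonglongrightarrow> h x" for x
    proof -
      have "(\<lambda>n. LINT s|?N. h (x + s / Suc n)) \<longlonglongrightarrow> (LINT s|?N. h x)"
      proof (rule integral_dominated_convergence[where w = "\<lambda>_. B"])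
        show "AE s in ?N. (\<lambda>n. h (x + s / Suc n)) \<longlonglongrightarrow> h x"
        proof (rule AE_I2)
          fix s
          have "(\<lambda>n. x + s / Suc n) \<longlonglongrightarrow> x + 0" by (intro tendsto_intros inv)
          then show "(\<lambda>n. h (x + s / Suc n)) \<longlonglongrightarrow> h x"
            using cont by (auto intro: continuous_on_tendsto_compose)
        qed
      qed (use h0 hB in auto)
      then show ?thesis using N.prob_space by simp
    qed
    \<comment> \<open>The bound \<open>B\<close> on \<open>h\<close> supplies the dominating
      function; the inner averages converge pointwise by continuity of \<open>h\<close>.\<close>
    have "(\<lambda>n. LINT x|lborel. h x * (LINT s|?N. h (x + s / Suc n))) \<longlonglongrightarrow> (LINT x|lborel. h x * h x)"
    proof (rule integral_dominated_convergence[where w = "\<lambda>x. h x * B"])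
      show "AE x in lborel. norm (h x * (LINT s|?N. h (x + s / Suc n))) \<le> h x * B" for n
      proof (rule AE_I2)
        fix x
        have "norm (LINT s|?N. h (x + s / Suc n)) \<le> B"
        proof -
          have "integrable ?N (\<lambda>s. h (x + s / Suc n))"
            by (rule N.integrable_const_bound[where B = B]) (use h0 hB in auto)
          then have "(LINT s|?N. h (x + s / Suc n)) \<le> B"
            by (rule N.integral_le_const) (use hB in auto)
          moreover have "0 \<le> (LINT s|?N. h (x + s / Suc n))"
            using h0 by (intro Bochner_Integration.integral_nonneg) auto
          ultimately show ?thesis by simp
        qed
        then show "norm (h x * (LINT s|?N. h (x + s / Suc n))) \<le> h x * B"
          using h0[of x] by (simp add: abs_mult mult_left_mono)
      qed
      show "AE x in lborel. (\<lambda>n. h x * (LINT s|?N. h (x + s / Suc n))) \<longlonglongrightarrow> h x * h x"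
        by (intro AE_I2 tendsto_intros inner)
    qed (use int in auto)
    then show ?thesis
      unfolding regularised[OF of_nat_0_less_iff[THEN iffD2, OF zero_less_Suc]]
      by (intro tendsto_intros) (simp add: power2_eq_square)
  qed
  ultimately show ?thesis by (rule LIMSEQ_unique)
qed

text \<open>Euler's integral after the substitution t = exp x: the Jacobian exp x turns the power z
  - 1 of t into exp (z x).\<close>

lemma Gamma_fourier:
  assumes "0 < a"
  shows "has_bochner_integral lborel
    (\<lambda>x. complex_of_real (exp (a * x - exp x)) * iexp (y * x)) (Gamma (Complex a y))"
proof -
  let ?z = "Complex a y"
  let ?f = "\<lambda>t. complex_of_real t powr (?z - 1) / of_real (exp t)"
  let ?g = "\<lambda>x. complex_of_real (exp (a * x - exp x)) * iexp (y * x)"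
  have range_exp: "range (exp :: real \<Rightarrow> real) = {0<..}"
    by (auto simp: image_iff intro!: exI[of _ "ln _"] exp_ln[symmetric])
  have "?f absolutely_integrable_on range exp \<and> integral (range exp) ?f = Gamma ?z"
    using absolutely_integrable_Gamma_integral'[of ?z] Gamma_integral_complex'[of ?z] assms
    by (simp add: range_exp integral_unique)
  then have "(\<lambda>x. \<bar>exp x\<bar> *\<^sub>R ?f (exp x)) absolutely_integrable_on UNIV \<and>
      integral UNIV (\<lambda>x. \<bar>exp x\<bar> *\<^sub>R ?f (exp x)) = Gamma ?z"
    by (subst has_absolute_integral_change_of_variables_real)
       (auto intro!: derivative_eq_intros simp: inj_on_def)
  moreover have "(\<lambda>x. \<bar>exp x\<bar> *\<^sub>R ?f (exp x)) = ?g"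
  proof
    fix x :: real
    have "complex_of_real (exp x) powr (?z - 1) = exp ((?z - 1) * of_real x)"
      by (simp add: powr_def Ln_of_real)
    then have "\<bar>exp x\<bar> *\<^sub>R ?f (exp x) = exp (of_real x + (?z - 1) * of_real x - of_real (exp x))"
      by (simp add: scaleR_conv_of_real exp_add exp_diff exp_of_real)
    also have "of_real x + (?z - 1) * of_real x - of_real (exp x)
        = of_real (a * x - exp x) + \<i> * of_real (y * x)"
      by (simp add: complex_eq_iff algebra_simps)
    finally show "\<bar>exp x\<bar> *\<^sub>R ?f (exp x) = ?g x"
      by (simp add: exp_add flip: exp_of_real)
  qed
  ultimately have *: "set_integrable lebesgue UNIV ?g" "integral UNIV ?g = Gamma ?z" by auto
  then have "has_bochner_integral lebesgue ?g (Gamma ?z)"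
    using set_lebesgue_integral_eq_integral(2)[OF *(1)]
    by (simp add: has_bochner_integral_iff set_integrable_def set_lebesgue_integral_def)
  then show ?thesis
    by (simp add: has_bochner_integral_iff integrable_completion integral_completion)
qed

lemma Gamma_real_exp_integral:
  fixes a :: real
  assumes "0 < a"
  shows "has_bochner_integral lborel (\<lambda>x. exp (a * x - exp x)) (Gamma a)"
proof -
  have "has_bochner_integral lborel (\<lambda>x. complex_of_real (exp (a * x - exp x)))
      (complex_of_real (Gamma a))"
    using Gamma_fourier[OF assms, of 0] by (simp add: Gamma_complex_of_real flip: complex_of_real_def)
  then show ?thesis
    by (simp only: has_bochner_integral_iff complex_of_real_integrable_eq integral_complex_of_real
        of_real_eq_iff)
qed

lemma gamma_weight_continuous:
  assumes "0 < r"
  shows "continuous_on UNIV (gamma_weight r)"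
  unfolding gamma_weight_def Complex_eq using assms
  by (intro continuous_intros continuous_on_compose2[OF continuous_on_Gamma[of "{z. 0 < Re z}"]])
    (auto dest: nonpos_Ints_Re_pos)

text \<open>Plancherel with h x = exp (r x / 2 - exp x), whose transform at y is Gamma (r/2 + i y),
  so that |H y|^2 is the weight at 2 y. The square of \<open>h\<close> is again a Gamma integrand,
  now of parameter r. The rescaling u = 2 y contributes the second factor 2 in 4 pi.\<close>

lemma gamma_weight_integral:
  assumes "0 < r"
  shows "has_bochner_integral lborel (gamma_weight r) (4 * pi * Gamma r / 2 powr r)"
proof -
  define a where "a = r / 2"
  have a: "0 < a" using assms by (simp add: a_def)
  define h where "h x = exp (a * x - exp x)" for x
  define H where "H y = Gamma (Complex a y)" for y
  have [measurable]: "gamma_weight r \<in> borel_measurable borel"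
    using gamma_weight_continuous[OF assms] by (rule borel_measurable_continuous_onI)
  have half: "1 / 2 < pi / 2" using pi_ge_two by linarith
  obtain C where C: "0 < C" "\<And>u. gamma_weight r u \<le> C * exp (- (1/2) * \<bar>u\<bar>)"
    using gamma_weight_decay[OF assms, of "1/2"] half by blast
  have int: "integrable lborel (gamma_weight r)"
  proof (rule Bochner_Integration.integrable_bound)
    show "integrable lborel (\<lambda>u. C * exp (- (1/2) * \<bar>u\<bar>))"
      by (intro integrable_mult_right integrable_exp_abs) simp
    show "AE u in lborel. norm (gamma_weight r u) \<le> norm (C * exp (- (1/2) * \<bar>u\<bar>))"
      using C by (auto simp: gamma_weight_def abs_mult)
  qed measurable
  have HW: "(cmod (H y))\<^sup>2 = gamma_weight r (2 * y)" for y
    by (simp add: H_def gamma_weight_def a_def)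
  have "(LINT y|lborel. (cmod (H y))\<^sup>2) = 2 * pi * (LINT x|lborel. (h x)\<^sup>2)"
  proof (rule Plancherel)
    show "continuous_on UNIV h" unfolding h_def by (intro continuous_intros)
    show "integrable lborel h"
      using Gamma_real_exp_integral[OF a] unfolding h_def has_bochner_integral_iff by simp
    show "H y = (CLINT x|lborel. of_real (h x) * iexp (y * x))" for y
      using Gamma_fourier[OF a, of y] unfolding h_def H_def has_bochner_integral_iff by simp
    show "integrable lborel (\<lambda>y. (cmod (H y))\<^sup>2)"
      unfolding HW using lborel_integrable_real_affine[OF int, of 2 0] by simp
    \<comment> \<open>The exponent a x - exp x is largest at x = ln a.\<close>
    show "h x \<le> exp (a * ln a - a)" for x
    proof -
      have "a * (1 + (x - ln a)) \<le> a * exp (x - ln a)"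
        using a by (intro mult_left_mono exp_ge_add_one_self) auto
      also have "\<dots> = exp x" using a by (simp add: exp_diff)
      finally show ?thesis by (simp add: h_def algebra_simps)
    qed
  qed (simp add: h_def)
  also have "(LINT x|lborel. (h x)\<^sup>2) = Gamma r / 2 powr r"
  proof -
    \<comment> \<open>The 2 in front of exp x is moved into a shift of x by ln 2; this shift
      produces the denominator \<open>2 powr r\<close>.\<close>
    have "(h x)\<^sup>2 = exp (r * (ln 2 + 1 * x) - exp (ln 2 + 1 * x)) / 2 powr r" for x
      unfolding h_def a_def power2_eq_square exp_add[symmetric] powr_def
      by (simp add: exp_diff[symmetric] exp_add algebra_simps)
    then have "(LINT x|lborel. (h x)\<^sup>2)
        = (LINT x|lborel. exp (r * (ln 2 + 1 * x) - exp (ln 2 + 1 * x))) / 2 powr r"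
      by simp
    also have "(LINT x|lborel. exp (r * (ln 2 + 1 * x) - exp (ln 2 + 1 * x)))
        = (LINT x|lborel. exp (r * x - exp x))"
      by (subst (2) lborel_integral_real_affine[where c = 1 and t = "ln 2"]) auto
    also have "\<dots> = Gamma r"
      using Gamma_real_exp_integral[OF assms] by (simp add: has_bochner_integral_iff)
    finally show ?thesis .
  qed
  also have "(LINT y|lborel. (cmod (H y))\<^sup>2) = (LINT u|lborel. gamma_weight r u) / 2"
    unfolding HW by (subst (2) lborel_integral_real_affine[where c = 2 and t = 0]) auto
  finally show ?thesis using int by (simp add: has_bochner_integral_iff)
qed

section \<open>Contour shifts and moments\<close>

text \<open>Cauchy's theorem on the rectangle with corners -R - i, R - i, R + i, -R + i. The
  condition \<open>1 < b\<close> keeps it inside the domain, and the uniform exponential bound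
  removes the vertical sides as R grows.\<close>

lemma holomorphic_strip_shift:
  assumes holo: "F holomorphic_on {z. \<bar>Im z\<bar> < b}" and b: "1 < b" and k: "0 < k"
    and bound: "\<And>x t. \<bar>t\<bar> \<le> 1 \<Longrightarrow> cmod (F (Complex x t)) \<le> C * exp (- k * \<bar>x\<bar>)"
  shows "integrable lborel (\<lambda>x. F (Complex x 1))"
    and "integrable lborel (\<lambda>x. F (Complex x (-1)))"
    and "(CLINT x|lborel. F (Complex x 1)) = (CLINT x|lborel. F (Complex x (-1)))"
proof -
  have cont: "continuous_on {z. \<bar>Im z\<bar> < b} F"
    using holo by (rule holomorphic_on_imp_continuous_on)
  have cont_line: "continuous_on UNIV (\<lambda>x. F (Complex x t))" if "\<bar>t\<bar> \<le> 1" for t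
    unfolding Complex_eq
    by (intro continuous_on_compose2[OF cont] continuous_intros) (use that b in auto)
  have meas: "(\<lambda>x. F (Complex x t)) \<in> borel_measurable borel" if "\<bar>t\<bar> \<le> 1" for t
    using cont_line[OF that] by (rule borel_measurable_continuous_onI)
  have int: "integrable lborel (\<lambda>x. F (Complex x t))" if "\<bar>t\<bar> \<le> 1" for t
  proof (rule Bochner_Integration.integrable_bound)
    show "integrable lborel (\<lambda>x. C * exp (- k * \<bar>x\<bar>))"
      by (intro integrable_mult_right integrable_exp_abs k)
    show "AE x in lborel. norm (F (Complex x t)) \<le> norm (C * exp (- k * \<bar>x\<bar>))"
      by (intro AE_I2 order_trans[OF bound[OF that]]) simp
  qed (use meas[OF that] in simp)
  show int1: "integrable lborel (\<lambda>x. F (Complex x 1))"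
    and int2: "integrable lborel (\<lambda>x. F (Complex x (-1)))"
    by (auto intro: int)
  have horiz: "contour_integral (linepath (Complex (- R) t) (Complex R t)) F
      = (LINT x:{-R..R}|lborel. F (Complex x t))" if "0 < R" "\<bar>t\<bar> \<le> 1" for R t
  proof -
    have "contour_integral (linepath (Complex (- R) t) (Complex R t)) F
        = integral {-R..R} (\<lambda>x. F (Complex x t))"
    proof (rule contour_integral_unique)
      have "set_integrable lborel {-R..R} (\<lambda>x. F (Complex x t))"
        unfolding set_integrable_def using int[OF that(2)] by (rule integrable_mult_indicator[rotated]) simp
      then have "((\<lambda>x. F (Complex x t)) has_integral integral {-R..R} (\<lambda>x. F (Complex x t))) {-R..R}"
        by (intro integrable_integral set_borel_integral_eq_integral)
      then show "(F has_contour_integral integral {-R..R} (\<lambda>x. F (Complex x t)))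
          (linepath (Complex (- R) t) (Complex R t))"
      proof -
        assume "((\<lambda>x. F (Complex x t)) has_integral integral {-R..R} (\<lambda>x. F (Complex x t))) {-R..R}"
        then have "((\<lambda>z. F (z + Complex 0 t)) has_contour_integral integral {-R..R} (\<lambda>x. F (Complex x t)))
            (linepath (of_real (-R)) (of_real R))"
          using that(1)
          by (subst has_contour_integral_linepath_Reals_iff) (simp_all add: Complex_eq)
        moreover have "(+) (Complex 0 t) \<circ> linepath (of_real (-R)) (of_real R)
            = linepath (Complex (- R) t) (Complex R t)"
          by (auto simp: linepath_def complex_eq_iff fun_eq_iff algebra_simps)
        ultimately show ?thesis by (simp only: has_contour_integral_translate[symmetric])
      qed
    qed
    also have "\<dots> = (LINT x:{-R..R}|lborel. F (Complex x t))"
      by (rule set_borel_integral_eq_integral(2)[symmetric])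
         (use int[OF that(2)] in \<open>simp add: set_integrable_def integrable_mult_indicator\<close>)
    finally show ?thesis .
  qed
  have vert: "cmod (contour_integral (linepath (Complex x s) (Complex x t)) F) \<le> 2 * (C * exp (- k * \<bar>x\<bar>))"
    if "\<bar>s\<bar> \<le> 1" "\<bar>t\<bar> \<le> 1" for x s t
  proof -
    have sub: "closed_segment (Complex x s) (Complex x t) \<subseteq> {z. Re z = x \<and> \<bar>Im z\<bar> \<le> 1}"
    proof (rule closed_segment_subset)
      have "{z. Re z = x \<and> \<bar>Im z\<bar> \<le> 1} = {z. Re z \<le> x} \<inter> {z. Re z \<ge> x} \<inter> {z. Im z \<le> 1} \<inter> {z. Im z \<ge> -1}"
        by auto
      also have "convex \<dots>"
        by (intro convex_Int convex_halfspace_Re_le convex_halfspace_Re_ge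
            convex_halfspace_Im_le convex_halfspace_Im_ge)
      finally show "convex {z. Re z = x \<and> \<bar>Im z\<bar> \<le> 1}" .
    qed (use that in auto)
    \<comment> \<open>The sign of \<open>C\<close> follows from the bound at height 0, where a norm
      is estimated.\<close>
    have B: "0 \<le> C * exp (- k * \<bar>x\<bar>)"
      using bound[of 0 x] by (smt (verit) norm_ge_zero)
    have "cmod (contour_integral (linepath (Complex x s) (Complex x t)) F)
        \<le> C * exp (- k * \<bar>x\<bar>) * cmod (Complex x t - Complex x s)"
    proof (rule contour_integral_bound_linepath[OF _ B])
      show "F contour_integrable_on linepath (Complex x s) (Complex x t)"
        by (intro contour_integrable_continuous_linepath continuous_on_subset[OF cont])
           (use sub b in force)
      show "cmod (F z) \<le> C * exp (- k * \<bar>x\<bar>)" if "z \<in> closed_segment (Complex x s) (Complex x t)" for z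
        using that sub bound[of "Im z" "Re z"] by auto
    qed
    also have "cmod (Complex x t - Complex x s) = \<bar>t - s\<bar>"
      by (simp add: cmod_def)
    also have "C * exp (- k * \<bar>x\<bar>) * \<bar>t - s\<bar> \<le> C * exp (- k * \<bar>x\<bar>) * 2"
      using that B by (intro mult_left_mono) auto
    finally show ?thesis by simp
  qed
  \<comment> \<open>Only the two vertical sides survive; each has length 2 and an integrand of
    modulus at most C exp (- k R).\<close>
  have rect: "cmod ((LINT x:{-R..R}|lborel. F (Complex x (-1))) - (LINT x:{-R..R}|lborel. F (Complex x 1)))
      \<le> 4 * (C * exp (- k * R))" if R: "0 < R" for R
  proof -
    let ?a = "Complex (-R) (-1)" and ?b = "Complex R (-1)" and ?c = "Complex R 1" and ?d = "Complex (-R) 1"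
    have cvx: "convex {z. \<bar>Im z\<bar> < b}"
    proof -
      have "{z. \<bar>Im z\<bar> < b} = {z. Im z < b} \<inter> {z. Im z > -b}" by auto
      also have "convex \<dots>" by (intro convex_Int convex_halfspace_Im_lt convex_halfspace_Im_gt)
      finally show ?thesis .
    qed
    have seg: "closed_segment u v \<subseteq> {z. \<bar>Im z\<bar> < b}" if "u \<in> {?a,?b,?c,?d}" "v \<in> {?a,?b,?c,?d}" for u v
      by (rule closed_segment_subset[OF _ _ cvx]) (use that b in auto)
    have ci: "F contour_integrable_on linepath u v" if "u \<in> {?a,?b,?c,?d}" "v \<in> {?a,?b,?c,?d}" for u v
      by (intro contour_integrable_continuous_linepath continuous_on_subset[OF cont] seg that)
    have "(F has_contour_integral 0) (linepath ?a ?b +++ linepath ?b ?c +++ linepath ?c ?d +++ linepath ?d ?a)"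
    proof (rule Cauchy_theorem_convex_simple[OF holo cvx])
      show "path_image (linepath ?a ?b +++ linepath ?b ?c +++ linepath ?c ?d +++ linepath ?d ?a)
          \<subseteq> {z. \<bar>Im z\<bar> < b}"
        by (simp add: path_image_join seg)
    qed auto
    then have "contour_integral (linepath ?a ?b +++ linepath ?b ?c +++ linepath ?c ?d +++ linepath ?d ?a) F = 0"
      by (rule contour_integral_unique)
    then have "contour_integral (linepath ?a ?b) F + (contour_integral (linepath ?b ?c) F
        + (contour_integral (linepath ?c ?d) F + contour_integral (linepath ?d ?a) F)) = 0"
      using ci by (simp add: contour_integral_join contour_integrable_joinI valid_path_join)
    moreover have "contour_integral (linepath ?c ?d) F = - contour_integral (linepath ?d ?c) F"
      by (intro contour_integral_reverse_linepath continuous_on_subset[OF cont] seg) simp_all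
    ultimately have eq: "(LINT x:{-R..R}|lborel. F (Complex x (-1))) - (LINT x:{-R..R}|lborel. F (Complex x 1))
        = - contour_integral (linepath ?b ?c) F - contour_integral (linepath ?d ?a) F"
    proof -
      have *: "p - v = - q - w" if "p + (q + (s + w)) = 0" "s = - v" for p q s v w :: complex
        using that by algebra
      assume "contour_integral (linepath ?a ?b) F + (contour_integral (linepath ?b ?c) F
        + (contour_integral (linepath ?c ?d) F + contour_integral (linepath ?d ?a) F)) = 0"
        "contour_integral (linepath ?c ?d) F = - contour_integral (linepath ?d ?c) F"
      from *[OF this] show ?thesis using R by (subst (1 2) horiz[symmetric]) auto
    qed
    have "cmod (- contour_integral (linepath ?b ?c) F - contour_integral (linepath ?d ?a) F)
        \<le> cmod (contour_integral (linepath ?b ?c) F) + cmod (contour_integral (linepath ?d ?a) F)"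
      by (rule order_trans[OF norm_triangle_ineq4]) simp
    also have "\<dots> \<le> 4 * (C * exp (- k * R))"
      using vert[of "-1" 1 R] vert[of 1 "-1" "-R"] R by simp
    finally show ?thesis unfolding eq .
  qed
  have lim: "((\<lambda>R. LINT x:{-R..R}|lborel. F (Complex x t)) \<longlongrightarrow> (CLINT x|lborel. F (Complex x t))) at_top"
    if "\<bar>t\<bar> \<le> 1" for t
  proof -
    have "((\<lambda>R. LINT x|lborel. indicator {-R..R} x *\<^sub>R F (Complex x t)) \<longlongrightarrow> (CLINT x|lborel. F (Complex x t))) at_top"
    proof (rule integral_dominated_convergence_at_top[where w = "\<lambda>x. norm (F (Complex x t))"])
      show "\<forall>\<^sub>F R in at_top. AE x in lborel. norm (indicator {-R..R} x *\<^sub>R F (Complex x t)) \<le> norm (F (Complex x t))"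
        by (auto simp: indicator_def)
      show "AE x in lborel. ((\<lambda>R. indicator {-R..R} x *\<^sub>R F (Complex x t)) \<longlongrightarrow> F (Complex x t)) at_top"
      proof (rule AE_I2)
        fix x :: real
        have "\<forall>\<^sub>F R in at_top. indicator {-R..R} x *\<^sub>R F (Complex x t) = F (Complex x t)"
          using eventually_ge_at_top[of "\<bar>x\<bar>"] by eventually_elim (auto simp: indicator_def)
        then show "((\<lambda>R. indicator {-R..R} x *\<^sub>R F (Complex x t)) \<longlongrightarrow> F (Complex x t)) at_top"
          by (rule tendsto_eventually)
      qed
    qed (use int[OF that] meas[OF that] in auto)
    then show ?thesis by (simp add: set_lebesgue_integral_def)
  qed
  have "((\<lambda>R. (LINT x:{-R..R}|lborel. F (Complex x (-1))) - (LINT x:{-R..R}|lborel. F (Complex x 1))) \<longlongrightarrow> 0) at_top"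
  proof (rule Lim_null_comparison)
    show "\<forall>\<^sub>F R in at_top. cmod ((LINT x:{-R..R}|lborel. F (Complex x (-1)))
        - (LINT x:{-R..R}|lborel. F (Complex x 1))) \<le> 4 * (C * exp (- k * R))"
      using eventually_gt_at_top[of 0] by eventually_elim (rule rect)
    show "((\<lambda>R. 4 * (C * exp (- k * R))) \<longlongrightarrow> 0) at_top" using k by real_asymp
  qed
  moreover have "((\<lambda>R. (LINT x:{-R..R}|lborel. F (Complex x (-1))) - (LINT x:{-R..R}|lborel. F (Complex x 1)))
      \<longlongrightarrow> (CLINT x|lborel. F (Complex x (-1))) - (CLINT x|lborel. F (Complex x 1))) at_top"
    by (intro tendsto_diff lim) auto
  ultimately have "(CLINT x|lborel. F (Complex x (-1))) - (CLINT x|lborel. F (Complex x 1)) = 0"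
    by (rule tendsto_unique[OF trivial_limit_at_top_linorder, rotated])
  then show "(CLINT x|lborel. F (Complex x 1)) = (CLINT x|lborel. F (Complex x (-1)))" by simp
qed

text \<open>\<open>gamma_weight\<close> continued analytically to a strip.\<close>

definition gamma_weight_complex :: "real \<Rightarrow> complex \<Rightarrow> complex" where
  "gamma_weight_complex r z =
     Gamma (of_real (r / 2) + \<i> * z / 2) * Gamma (of_real (r / 2) - \<i> * z / 2)"

lemma gamma_weight_complex_of_real:
  "of_real (gamma_weight r x) = Gamma (Complex (r / 2) (x / 2)) * Gamma (Complex (r / 2) (- x / 2))"
proof -
  have "Complex (r / 2) (- x / 2) = cnj (Complex (r / 2) (x / 2))" by (simp add: complex_eq_iff)
  then show ?thesis
    unfolding gamma_weight_def complex_norm_square by (simp only: cnj_Gamma)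
qed

text \<open>Moving z by i or -i changes the two Gamma arguments by 1/2 in opposite directions. From
  real part (r + 1)/2 they reach r/2 and r/2 + 1, and the functional equation brings the larger one
  back to r/2 with a linear factor.\<close>

lemma gamma_weight_complex_shift:
  assumes "0 < r"
  shows "gamma_weight_complex (r + 1) (Complex x 1) = Complex r (- x) / 2 * gamma_weight r x"
    and "gamma_weight_complex (r + 1) (Complex x (-1)) = Complex r x / 2 * gamma_weight r x"
proof -
  have G: "Gamma (Complex (r / 2) y + 1) = Complex (r / 2) y * Gamma (Complex (r / 2) y)" for y
    using assms by (intro Gamma_plus1 nonpos_Ints_Re_pos) simp
  have e: "of_real ((r + 1) / 2) + \<i> * Complex x 1 / 2 = Complex (r / 2) (x / 2)"
    "of_real ((r + 1) / 2) - \<i> * Complex x 1 / 2 = Complex (r / 2) (- x / 2) + 1"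
    "of_real ((r + 1) / 2) + \<i> * Complex x (-1) / 2 = Complex (r / 2) (x / 2) + 1"
    "of_real ((r + 1) / 2) - \<i> * Complex x (-1) / 2 = Complex (r / 2) (- x / 2)"
    by (simp_all add: complex_eq_iff field_simps)
  have c: "Complex r (- x) / 2 = Complex (r / 2) (- x / 2)" "Complex r x / 2 = Complex (r / 2) (x / 2)"
    by (simp_all add: complex_eq_iff)
  show "gamma_weight_complex (r + 1) (Complex x 1) = Complex r (- x) / 2 * gamma_weight r x"
    "gamma_weight_complex (r + 1) (Complex x (-1)) = Complex r x / 2 * gamma_weight r x"
    unfolding gamma_weight_complex_def e G c gamma_weight_complex_of_real by (simp_all only: mult_ac)
qed

lemma gamma_weight_complex_holomorphic:
  "gamma_weight_complex r holomorphic_on {z. \<bar>Im z\<bar> < r}"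
  unfolding gamma_weight_complex_def
  by (intro holomorphic_intros nonpos_Ints_Re_pos) auto

text \<open>For |t| \<le> 1 both Gamma arguments have real part in [r/2, r/2 + 1].
  \<open>norm_Gamma_mono\<close> raises both to the right end point \<open>b\<close>, where the
  product is the real weight of parameter r + 2 and decays. The ratio of real Gamma values is
  bounded by compactness.\<close>

lemma gamma_weight_complex_bound:
  assumes r: "0 < r" and k: "k < pi / 2"
  obtains C where "0 < C"
    and "\<And>x t. \<bar>t\<bar> \<le> 1 \<Longrightarrow> cmod (gamma_weight_complex (r + 1) (Complex x t)) \<le> C * exp (- k * \<bar>x\<bar>)"
proof -
  define b where "b = r / 2 + 1"
  have b: "0 < Gamma b" using r by (auto simp: b_def intro: Gamma_real_pos)
  have "compact (Gamma ` {r / 2..b})"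
    by (intro compact_continuous_image continuous_on_Gamma)
       (use r in \<open>auto elim!: nonpos_Ints_cases\<close>)
  then obtain G0 where "\<forall>s\<in>{r / 2..b}. norm (Gamma s) \<le> G0"
    by (meson bounded_iff compact_imp_bounded imageI)
  then have G: "0 < max G0 1" "\<And>s. s \<in> {r / 2..b} \<Longrightarrow> Gamma s \<le> max G0 1"
    by (auto simp: le_max_iff_disj abs_le_iff)
  define G where "G = max G0 1"
  note G = G[folded G_def]
  obtain C where C: "0 < C" "\<And>u. gamma_weight (r + 2) u \<le> C * exp (- k * \<bar>u\<bar>)"
    using gamma_weight_decay[of "r + 2" k] r k by auto
  define D where "D = G / Gamma b"
  have D: "0 < D" using G b by (simp add: D_def)
  have one: "cmod (Gamma (Complex s y)) \<le> D * cmod (Gamma (Complex b y))" if "s \<in> {r / 2..b}" for s y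
  proof -
    have "cmod (Gamma (Complex s y)) * Gamma b \<le> cmod (Gamma (Complex b y)) * Gamma s"
      using that r by (intro norm_Gamma_mono) auto
    also have "\<dots> \<le> cmod (Gamma (Complex b y)) * G"
      using G(2)[OF that] by (intro mult_left_mono) auto
    finally show ?thesis using b by (simp add: D_def field_simps)
  qed
  show ?thesis
  proof
    show "0 < D\<^sup>2 * C" using C D by simp
    fix x t :: real
    assume t: "\<bar>t\<bar> \<le> 1"
    have "of_real ((r + 1) / 2) + \<i> * Complex x t / 2 = Complex ((r + 1 - t) / 2) (x / 2)"
      "of_real ((r + 1) / 2) - \<i> * Complex x t / 2 = Complex ((r + 1 + t) / 2) (- x / 2)"
      by (simp_all add: complex_eq_iff field_simps)
    then have "cmod (gamma_weight_complex (r + 1) (Complex x t))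
        = cmod (Gamma (Complex ((r + 1 - t) / 2) (x / 2))) * cmod (Gamma (Complex ((r + 1 + t) / 2) (- x / 2)))"
      by (simp only: gamma_weight_complex_def norm_mult)
    also have "\<dots> \<le> (D * cmod (Gamma (Complex b (x / 2)))) * (D * cmod (Gamma (Complex b (- x / 2))))"
      using t D by (intro mult_mono one) (auto simp: b_def field_simps)
    also have "\<dots> = D\<^sup>2 * cmod (of_real (gamma_weight (r + 2) x))"
      unfolding gamma_weight_complex_of_real norm_mult
      by (simp add: b_def power2_eq_square add_divide_distrib)
    also have "\<dots> = D\<^sup>2 * gamma_weight (r + 2) x"
      unfolding norm_of_real by (simp add: gamma_weight_def)
    also have "\<dots> \<le> D\<^sup>2 * (C * exp (- k * \<bar>x\<bar>))" using C by (intro mult_left_mono) auto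
    finally show "cmod (gamma_weight_complex (r + 1) (Complex x t)) \<le> D\<^sup>2 * C * exp (- k * \<bar>x\<bar>)"
      by simp
  qed
qed

text \<open>Moving the line of integration from \<open>Im z = 1\<close> to \<open>Im z = -1\<close> gives \<open>\<integral> g = \<integral> cnj g\<close> for
  \<open>g x = E (x + \<i>) * (r - \<i> x) * gamma_weight r x / 2\<close>; every moment identity below is an
  instance for a suitable \<open>E\<close>.\<close>

lemma gamma_weight_shift:
  assumes r: "0 < r" and holo: "E holomorphic_on {z. \<bar>Im z\<bar> < r + 1}" and \<kappa>: "\<kappa> < pi / 2"
    and bound: "\<And>x t. \<bar>t\<bar> \<le> 1 \<Longrightarrow> cmod (E (Complex x t)) \<le> D * exp (\<kappa> * \<bar>x\<bar>)"
    and cnj: "\<And>x. E (Complex x (-1)) = cnj (E (Complex x 1))"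
  shows "has_bochner_integral lborel (\<lambda>x. Im (E (Complex x 1) * Complex r (- x)) * gamma_weight r x) 0"
proof -
  \<comment> \<open>The midpoint between \<kappa> and pi/2: decay at rate \<open>k\<close> beats the
    growth of \<open>E\<close> and still leaves the rate k - \<kappa>.\<close>
  define k where "k = (pi / 2 + \<kappa>) / 2"
  have k: "k < pi / 2" "0 < k - \<kappa>" using \<kappa> by (simp_all add: k_def field_simps)
  obtain C where C: "0 < C"
    "\<And>x t. \<bar>t\<bar> \<le> 1 \<Longrightarrow> cmod (gamma_weight_complex (r + 1) (Complex x t)) \<le> C * exp (- k * \<bar>x\<bar>)"
    using gamma_weight_complex_bound[OF r k(1)] by blast
  define F where "F z = E z * gamma_weight_complex (r + 1) z" for z
  have F: "F holomorphic_on {z. \<bar>Im z\<bar> < r + 1}"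
    unfolding F_def[abs_def] by (intro holomorphic_on_mult holo gamma_weight_complex_holomorphic)
  have bF: "cmod (F (Complex x t)) \<le> (D * C) * exp (- (k - \<kappa>) * \<bar>x\<bar>)" if "\<bar>t\<bar> \<le> 1" for x t
  proof -
    have "cmod (F (Complex x t)) \<le> (D * exp (\<kappa> * \<bar>x\<bar>)) * (C * exp (- k * \<bar>x\<bar>))"
      unfolding F_def norm_mult using bound[OF that] C(2)[OF that]
      by (intro mult_mono) (auto intro: order_trans[OF norm_ge_zero])
    also have "\<dots> = (D * C) * (exp (\<kappa> * \<bar>x\<bar>) * exp (- k * \<bar>x\<bar>))" by simp
    also have "exp (\<kappa> * \<bar>x\<bar>) * exp (- k * \<bar>x\<bar>) = exp (- (k - \<kappa>) * \<bar>x\<bar>)"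
      unfolding exp_add[symmetric] by (simp add: algebra_simps)
    finally show ?thesis .
  qed
  have r1: "1 < r + 1" using r by simp
  note S = holomorphic_strip_shift[OF F r1 k(2) bF]
  have F1: "F (Complex x 1) = E (Complex x 1) * Complex r (- x) * (gamma_weight r x / 2)" for x
    unfolding F_def gamma_weight_complex_shift[OF r] by simp
  have F2: "F (Complex x (-1)) = cnj (F (Complex x 1))" for x
    unfolding F1 unfolding F_def gamma_weight_complex_shift[OF r] cnj
    by (simp add: complex_eq_iff algebra_simps)
  have "(CLINT x|lborel. F (Complex x 1)) = cnj (CLINT x|lborel. F (Complex x 1))"
    using S(3) unfolding F2 by simp
  then have "Im (CLINT x|lborel. F (Complex x 1)) = 0" by (simp add: complex_eq_iff)
  \<comment> \<open>The factor 2 cancels the halves in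
    \<open>gamma_weight_complex_shift\<close>.\<close>
  then have "has_bochner_integral lborel (\<lambda>x. 2 * Im (F (Complex x 1))) (2 * 0)"
    using S(1) by (intro has_bochner_integral_mult_right) (simp add: has_bochner_integral_iff)
  then show ?thesis by (simp add: F1)
qed

section \<open>Moments and moment generating function of the tilted weight\<close>

lemma integrable_mult_gamma_weight:
  fixes g :: "real \<Rightarrow> real"
  assumes r: "0 < r" and [measurable]: "g \<in> borel_measurable borel" and \<kappa>: "\<kappa> < pi / 2"
    and bound: "\<And>x. \<bar>g x\<bar> \<le> D * exp (\<kappa> * \<bar>x\<bar>)"
  shows "integrable lborel (\<lambda>x. g x * gamma_weight r x)"
proof -
  define k where "k = (pi / 2 + \<kappa>) / 2"
  have k: "k < pi / 2" "0 < k - \<kappa>" using \<kappa> by (simp_all add: k_def field_simps)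
  obtain C where C: "0 < C" "\<And>x. gamma_weight r x \<le> C * exp (- k * \<bar>x\<bar>)"
    using gamma_weight_decay[OF r k(1)] by blast
  have [measurable]: "gamma_weight r \<in> borel_measurable borel"
    using gamma_weight_continuous[OF r] by (rule borel_measurable_continuous_onI)
  show ?thesis
  proof (rule Bochner_Integration.integrable_bound)
    show "integrable lborel (\<lambda>x. (D * C) * exp (- (k - \<kappa>) * \<bar>x\<bar>))"
      by (intro integrable_mult_right integrable_exp_abs k)
    show "AE x in lborel. norm (g x * gamma_weight r x) \<le> norm ((D * C) * exp (- (k - \<kappa>) * \<bar>x\<bar>))"
    proof (rule AE_I2)
      fix x
      have "norm (g x * gamma_weight r x) \<le> (D * exp (\<kappa> * \<bar>x\<bar>)) * (C * exp (- k * \<bar>x\<bar>))"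
        unfolding real_norm_def abs_mult using bound[of x] C(2)[of x]
        by (intro mult_mono) (auto simp: gamma_weight_def intro: order_trans[OF abs_ge_zero])
      also have "\<dots> = (D * C) * (exp (\<kappa> * \<bar>x\<bar>) * exp (- k * \<bar>x\<bar>))" by simp
      also have "exp (\<kappa> * \<bar>x\<bar>) * exp (- k * \<bar>x\<bar>) = exp (- (k - \<kappa>) * \<bar>x\<bar>)"
        unfolding exp_add[symmetric] by (simp add: algebra_simps)
      finally show "norm (g x * gamma_weight r x) \<le> norm ((D * C) * exp (- (k - \<kappa>) * \<bar>x\<bar>))"
        by (rule order_trans) simp
    qed
  qed measurable
qed

text \<open>A tilt inside the open range still has room for a quadratic factor: half of the gap pi/2
  - |\<theta>| absorbs it.\<close>

lemma quadratic_exp_bound: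
  fixes \<theta> c :: real
  assumes "\<bar>\<theta>\<bar> < pi / 2" "0 \<le> c"
  obtains \<kappa> D where "\<kappa> < pi / 2" "0 < D" "\<And>x. (c + x\<^sup>2) * exp (\<bar>\<theta>\<bar> * \<bar>x\<bar>) \<le> D * exp (\<kappa> * \<bar>x\<bar>)"
proof -
  define d where "d = (pi / 2 - \<bar>\<theta>\<bar>) / 2"
  have d: "0 < d" "\<bar>\<theta>\<bar> + d < pi / 2" using assms by (simp_all add: d_def field_simps)
  obtain D where D: "0 < D" "\<And>x. c + x\<^sup>2 \<le> D * exp (d * \<bar>x\<bar>)"
    using square_le_exp[OF assms(2) d(1)] by blast
  show ?thesis
  proof (rule that[OF d(2) D(1)])
    fix x :: real
    have "(c + x\<^sup>2) * exp (\<bar>\<theta>\<bar> * \<bar>x\<bar>) \<le> (D * exp (d * \<bar>x\<bar>)) * exp (\<bar>\<theta>\<bar> * \<bar>x\<bar>)"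
      by (intro mult_right_mono D) auto
    then show "(c + x\<^sup>2) * exp (\<bar>\<theta>\<bar> * \<bar>x\<bar>) \<le> D * exp ((\<bar>\<theta>\<bar> + d) * \<bar>x\<bar>)"
      by (simp add: exp_add[symmetric] algebra_simps)
  qed
qed

lemma exp_tilt_le: "exp (\<theta> * x) \<le> exp (\<bar>\<theta>\<bar> * \<bar>x\<bar>)" for \<theta> x :: real
  by (metis abs_ge_self abs_mult exp_le_cancel_iff)

lemma abs_le_1_plus_square: "\<bar>x\<bar> \<le> 1 + x\<^sup>2" for x :: real
proof -
  have "0 \<le> (1 - \<bar>x\<bar>)\<^sup>2 + \<bar>x\<bar>" by simp
  then show ?thesis by (simp add: power2_diff)
qed

lemma gamma_weight_tilted_integrable:
  assumes "0 < r" "\<bar>\<theta>\<bar> < pi / 2"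
  shows "integrable lborel (\<lambda>x. exp (\<theta> * x) * gamma_weight r x)"
    and "integrable lborel (\<lambda>x. x * exp (\<theta> * x) * gamma_weight r x)"
    and "integrable lborel (\<lambda>x. x\<^sup>2 * exp (\<theta> * x) * gamma_weight r x)"
proof -
  obtain \<kappa> D where D: "\<kappa> < pi / 2" "0 < D" "\<And>x. (1 + x\<^sup>2) * exp (\<bar>\<theta>\<bar> * \<bar>x\<bar>) \<le> D * exp (\<kappa> * \<bar>x\<bar>)"
    using quadratic_exp_bound[OF assms(2), of 1] by auto
  have b: "\<bar>p * exp (\<theta> * x)\<bar> \<le> D * exp (\<kappa> * \<bar>x\<bar>)" if "\<bar>p\<bar> \<le> 1 + x\<^sup>2" for p x
  proof -
    have "\<bar>p * exp (\<theta> * x)\<bar> \<le> (1 + x\<^sup>2) * exp (\<bar>\<theta>\<bar> * \<bar>x\<bar>)"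
      unfolding abs_mult using that exp_tilt_le[of \<theta> x] by (intro mult_mono) auto
    also note D(3)[of x]
    finally show ?thesis .
  qed
  note I = integrable_mult_gamma_weight[OF assms(1) _ D(1), where D = D]
  have "\<bar>exp (\<theta> * x)\<bar> \<le> D * exp (\<kappa> * \<bar>x\<bar>)" for x using b[of 1 x] by simp
  then show "integrable lborel (\<lambda>x. exp (\<theta> * x) * gamma_weight r x)"
    by (intro I) auto
  show "integrable lborel (\<lambda>x. x * exp (\<theta> * x) * gamma_weight r x)"
    by (intro I b abs_le_1_plus_square) auto
  show "integrable lborel (\<lambda>x. x\<^sup>2 * exp (\<theta> * x) * gamma_weight r x)"
    by (intro I b) auto
qed

text \<open>At height 1 the exponential acquires the phase e^(i \<theta>), and the imaginary part of
  e^(i \<theta>) (r - i x) is r sin \<theta> - x cos \<theta>. With the extra factor z = x + i it is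
  (r - x^2) cos \<theta> + (r + 1) x sin \<theta>. Integrating to zero, these determine the first
  moment and then the second, since cos \<theta> does not vanish.\<close>

lemma gamma_weight_tilted_moments:
  assumes r: "0 < r" and \<theta>: "\<bar>\<theta>\<bar> < pi / 2"
  defines "M \<equiv> LINT x|lborel. exp (\<theta> * x) * gamma_weight r x"
  shows "has_bochner_integral lborel (\<lambda>x. x * exp (\<theta> * x) * gamma_weight r x) (r * tan \<theta> * M)"
    and "has_bochner_integral lborel (\<lambda>x. x\<^sup>2 * exp (\<theta> * x) * gamma_weight r x)
      ((r + r * (r + 1) * (tan \<theta>)\<^sup>2) * M)"
proof -
  have "- (pi / 2) < \<theta>" "\<theta> < pi / 2" using \<theta> by linarith+
  then have c: "cos \<theta> \<noteq> 0" using cos_gt_zero_pi[of \<theta>] by simp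
  note I = gamma_weight_tilted_integrable[OF r \<theta>]
  \<comment> \<open>The constant 2 accommodates the test function with the factor z, because |x + i
    t| \<le> |x| + 1 \<le> 2 + x^2.\<close>
  obtain \<kappa> D where D: "\<kappa> < pi / 2" "0 < D" "\<And>x. (2 + x\<^sup>2) * exp (\<bar>\<theta>\<bar> * \<bar>x\<bar>) \<le> D * exp (\<kappa> * \<bar>x\<bar>)"
    using quadratic_exp_bound[OF \<theta>, of 2] by auto
  have b: "cmod (p * exp (of_real \<theta> * Complex x t)) \<le> D * exp (\<kappa> * \<bar>x\<bar>)" if "cmod p \<le> 2 + x\<^sup>2" for p x t
  proof -
    have "cmod (p * exp (of_real \<theta> * Complex x t)) \<le> (2 + x\<^sup>2) * exp (\<bar>\<theta>\<bar> * \<bar>x\<bar>)"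
      unfolding norm_mult norm_exp_eq_Re using that exp_tilt_le[of \<theta> x] by (intro mult_mono) auto
    also note D(3)[of x]
    finally show ?thesis .
  qed
  have e: "exp (of_real \<theta> * Complex x t) = exp (\<theta> * x) *\<^sub>R Complex (cos (\<theta> * t)) (sin (\<theta> * t))" for x t
    by (simp add: exp_eq_polar complex_eq_iff cis.ctr)
  have "has_bochner_integral lborel
    (\<lambda>x. Im (exp (of_real \<theta> * Complex x 1) * Complex r (- x)) * gamma_weight r x) 0"
  proof (rule gamma_weight_shift[OF r _ D(1)])
    show "(\<lambda>z. exp (of_real \<theta> * z)) holomorphic_on {z. \<bar>Im z\<bar> < r + 1}"
      by (intro holomorphic_intros)
    show "cmod (exp (of_real \<theta> * Complex x t)) \<le> D * exp (\<kappa> * \<bar>x\<bar>)" for x t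
      using b[of 1 x t] by simp
    show "exp (of_real \<theta> * Complex x (- 1)) = cnj (exp (of_real \<theta> * Complex x 1))" for x
      unfolding e by (simp add: complex_eq_iff)
  qed
  then have "(LINT x|lborel. r * sin \<theta> * (exp (\<theta> * x) * gamma_weight r x)
      - cos \<theta> * (x * exp (\<theta> * x) * gamma_weight r x)) = 0"
    unfolding e by (simp add: has_bochner_integral_iff algebra_simps)
  then have m1: "cos \<theta> * (LINT x|lborel. x * exp (\<theta> * x) * gamma_weight r x) = r * sin \<theta> * M"
    using I by (simp add: M_def)
  then show "has_bochner_integral lborel (\<lambda>x. x * exp (\<theta> * x) * gamma_weight r x) (r * tan \<theta> * M)"
    using I(2) c by (simp add: has_bochner_integral_iff tan_def field_simps)
  have "has_bochner_integral lborel
    (\<lambda>x. Im (Complex x 1 * exp (of_real \<theta> * Complex x 1) * Complex r (- x)) * gamma_weight r x) 0"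
  proof (rule gamma_weight_shift[OF r _ D(1)])
    show "(\<lambda>z. z * exp (of_real \<theta> * z)) holomorphic_on {z. \<bar>Im z\<bar> < r + 1}"
      by (intro holomorphic_intros)
    show "cmod (Complex x t * exp (of_real \<theta> * Complex x t)) \<le> D * exp (\<kappa> * \<bar>x\<bar>)" if "\<bar>t\<bar> \<le> 1" for x t
    proof (rule b)
      have "cmod (Complex x t) \<le> \<bar>x\<bar> + \<bar>t\<bar>" using cmod_le[of "Complex x t"] by simp
      then show "cmod (Complex x t) \<le> 2 + x\<^sup>2" using that abs_le_1_plus_square[of x] by linarith
    qed
    show "Complex x (- 1) * exp (of_real \<theta> * Complex x (- 1)) = cnj (Complex x 1 * exp (of_real \<theta> * Complex x 1))" for x
      unfolding e by (simp add: complex_eq_iff)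
  qed
  then have "(LINT x|lborel. r * cos \<theta> * (exp (\<theta> * x) * gamma_weight r x)
      + (r + 1) * sin \<theta> * (x * exp (\<theta> * x) * gamma_weight r x)
      - cos \<theta> * (x\<^sup>2 * exp (\<theta> * x) * gamma_weight r x)) = 0"
    unfolding e by (simp add: has_bochner_integral_iff algebra_simps power2_eq_square)
  then have m2: "cos \<theta> * (LINT x|lborel. x\<^sup>2 * exp (\<theta> * x) * gamma_weight r x)
      = r * cos \<theta> * M + (r + 1) * sin \<theta> * (LINT x|lborel. x * exp (\<theta> * x) * gamma_weight r x)"
    using I by (simp add: M_def)
  have "cos \<theta> * (cos \<theta> * (LINT x|lborel. x\<^sup>2 * exp (\<theta> * x) * gamma_weight r x))
      = (r * (cos \<theta>)\<^sup>2 + (r + 1) * r * (sin \<theta>)\<^sup>2) * M"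
    unfolding m2 using m1 by algebra
  then have "(LINT x|lborel. x\<^sup>2 * exp (\<theta> * x) * gamma_weight r x) = (r + r * (r + 1) * (tan \<theta>)\<^sup>2) * M"
    using c by (simp add: tan_def field_simps power2_eq_square)
  then show "has_bochner_integral lborel (\<lambda>x. x\<^sup>2 * exp (\<theta> * x) * gamma_weight r x)
      ((r + r * (r + 1) * (tan \<theta>)\<^sup>2) * M)"
    using I(3) by (simp add: has_bochner_integral_iff)
qed

text \<open>Dominated convergence along sequences of increments. Restricting to |h| < d keeps every
  difference quotient below the tilt \<kappa> = |\<theta>| + d, which is still less than
  pi/2.\<close>

lemma gamma_weight_mgf_deriv:
  assumes r: "0 < r" and \<theta>: "\<bar>\<theta>\<bar> < pi / 2"
  shows "((\<lambda>t. LINT x|lborel. exp (t * x) * gamma_weight r x) has_real_derivative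
    (LINT x|lborel. x * exp (\<theta> * x) * gamma_weight r x)) (at \<theta>)"
proof -
  let ?w = "gamma_weight r"
  define d where "d = (pi / 2 - \<bar>\<theta>\<bar>) / 2"
  have d: "0 < d" "\<bar>\<theta>\<bar> + d < pi / 2" using \<theta> by (simp_all add: d_def field_simps)
  define \<kappa> where "\<kappa> = \<bar>\<theta>\<bar> + d"
  have \<kappa>: "\<bar>\<kappa>\<bar> < pi / 2" using d by (simp add: \<kappa>_def)
  have [measurable]: "?w \<in> borel_measurable borel"
    using gamma_weight_continuous[OF r] by (rule borel_measurable_continuous_onI)
  have w0: "0 \<le> ?w x" for x by (simp add: gamma_weight_def)
  have expm1: "\<bar>exp y - 1\<bar> \<le> \<bar>y\<bar> * exp \<bar>y\<bar>" for y :: real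
  proof (cases "0 \<le> y")
    case True
    have "exp y * (1 + (- y)) \<le> exp y * exp (- y)" by (intro mult_left_mono exp_ge_add_one_self) auto
    then show ?thesis using True by (simp add: exp_minus algebra_simps)
  next
    case False
    have "- y \<le> - (y * exp (- y))" using False mult_left_mono[of 1 "exp (- y)" "- y"] by simp
    moreover have "\<bar>y\<bar> * exp \<bar>y\<bar> = - (y * exp (- y))" "\<bar>exp y - 1\<bar> = 1 - exp y"
      using False by simp_all
    ultimately show ?thesis using exp_ge_add_one_self[of y] by linarith
  qed
  \<comment> \<open>The natural majorant |x| exp (\<kappa> |x|) times the weight is replaced by a
    sum over the tilts \<kappa> and -\<kappa>, whose integrability is the first-moment statement
    already available.\<close>
  let ?dom = "\<lambda>x. \<bar>x * exp (\<kappa> * x) * ?w x\<bar> + \<bar>x * exp (- \<kappa> * x) * ?w x\<bar>"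
  let ?Q = "\<lambda>h x. (exp ((\<theta> + h) * x) * ?w x - exp (\<theta> * x) * ?w x) / h"
  have I: "integrable lborel (\<lambda>x. exp (t * x) * ?w x)" if "\<bar>t\<bar> < pi / 2" for t
    using gamma_weight_tilted_integrable(1)[OF r that] .
  have dom: "integrable lborel ?dom"
    using gamma_weight_tilted_integrable(2)[OF r, of \<kappa>] gamma_weight_tilted_integrable(2)[OF r, of "- \<kappa>"] \<kappa>
    by (intro Bochner_Integration.integrable_add integrable_abs) auto
  have bnd: "\<bar>?Q h x\<bar> \<le> ?dom x" if "h \<in> {-d<..<d}" "h \<noteq> 0" for h x
  proof -
    have h: "\<bar>h\<bar> < d" using that by auto
    have eq: "?Q h x = exp (\<theta> * x) * (exp (h * x) - 1) / h * ?w x"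
      by (simp add: exp_add algebra_simps diff_divide_distrib)
    have "\<bar>?Q h x\<bar> = exp (\<theta> * x) * \<bar>exp (h * x) - 1\<bar> / \<bar>h\<bar> * ?w x"
      unfolding eq using w0[of x] by (simp only: abs_mult abs_divide abs_exp_cancel abs_of_nonneg)
    also have "\<dots> \<le> exp (\<theta> * x) * (\<bar>h * x\<bar> * exp \<bar>h * x\<bar>) / \<bar>h\<bar> * ?w x"
      by (intro mult_right_mono divide_right_mono mult_left_mono expm1 w0) auto
    also have "\<dots> = \<bar>x\<bar> * (exp (\<theta> * x) * exp (\<bar>h\<bar> * \<bar>x\<bar>)) * ?w x"
      using that by (simp add: abs_mult)
    also have "\<dots> \<le> \<bar>x\<bar> * (exp (\<bar>\<theta>\<bar> * \<bar>x\<bar>) * exp (d * \<bar>x\<bar>)) * ?w x"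
      using h by (intro mult_right_mono mult_left_mono mult_mono exp_tilt_le w0)
                 (auto intro: mult_right_mono)
    also have "exp (\<bar>\<theta>\<bar> * \<bar>x\<bar>) * exp (d * \<bar>x\<bar>) = exp (\<kappa> * \<bar>x\<bar>)"
      by (simp add: \<kappa>_def exp_add[symmetric] algebra_simps)
    also have "\<bar>x\<bar> * exp (\<kappa> * \<bar>x\<bar>) * ?w x \<le> ?dom x"
      unfolding abs_mult abs_exp_cancel abs_of_nonneg[OF w0]
      using w0[of x] by (cases "0 \<le> x") (auto intro!: mult_nonpos_nonneg)
    finally show ?thesis .
  qed
  have "((\<lambda>h. ((LINT x|lborel. exp ((\<theta> + h) * x) * ?w x) - (LINT x|lborel. exp (\<theta> * x) * ?w x)) / h)
      \<longlongrightarrow> (LINT x|lborel. x * exp (\<theta> * x) * ?w x)) (at 0 within {-d<..<d})"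
    unfolding tendsto_at_iff_sequentially
  proof (intro allI impI)
    fix X :: "nat \<Rightarrow> real"
    assume X: "\<forall>i. X i \<in> {-d<..<d} - {0}" "X \<longlonglongrightarrow> 0"
    have "(\<lambda>n. LINT x|lborel. ?Q (X n) x) \<longlonglongrightarrow> (LINT x|lborel. x * exp (\<theta> * x) * ?w x)"
    proof (rule integral_dominated_convergence[where w = ?dom])
      show "AE x in lborel. norm (?Q (X n) x) \<le> ?dom x" for n
        using X(1) bnd[of "X n"] by (intro AE_I2) auto
      show "AE x in lborel. (\<lambda>n. ?Q (X n) x) \<longlonglongrightarrow> x * exp (\<theta> * x) * ?w x"
      proof (rule AE_I2)
        fix x
        have "((\<lambda>t. exp (t * x) * ?w x) has_real_derivative x * exp (\<theta> * x) * ?w x) (at \<theta>)"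
          by (auto intro!: derivative_eq_intros)
        then have "((\<lambda>h. ?Q h x) \<longlongrightarrow> x * exp (\<theta> * x) * ?w x) (at 0)"
          by (simp add: DERIV_def)
        then show "(\<lambda>n. ?Q (X n) x) \<longlonglongrightarrow> x * exp (\<theta> * x) * ?w x"
          using X by (auto simp: tendsto_at_iff_sequentially o_def)
      qed
    qed (use dom in auto)
    moreover have eq: "(LINT x|lborel. ?Q (X n) x)
        = ((LINT x|lborel. exp ((\<theta> + X n) * x) * ?w x) - (LINT x|lborel. exp (\<theta> * x) * ?w x)) / X n" for n
    proof -
      have "\<bar>X n\<bar> < d" using X(1) by (auto dest: spec[of _ n])
      then have "\<bar>\<theta> + X n\<bar> < pi / 2" using d(2) by linarith
      then show ?thesis using I[of "\<theta> + X n"] I[OF \<theta>] by simp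
    qed
    ultimately show "((\<lambda>h. ((LINT x|lborel. exp ((\<theta> + h) * x) * ?w x) - (LINT x|lborel. exp (\<theta> * x) * ?w x)) / h) \<circ> X)
        \<longlonglongrightarrow> (LINT x|lborel. x * exp (\<theta> * x) * ?w x)"
      by (simp only: o_def eq)
  qed
  moreover have "at 0 within {-d<..<d} = at (0::real)"
    using d(1) by (intro at_within_open) auto
  ultimately show ?thesis by (simp add: DERIV_def)
qed

text \<open>The derivative of ln (cos t) is -tan t, so exp (r ln (cos t)) is the integrating factor
  of M' = r tan t M and the product is constant on the open interval. This is the origin of the
  factor with log cos \<theta> in the density.\<close>

lemma gamma_weight_mgf:
  assumes r: "0 < r" and \<theta>: "\<bar>\<theta>\<bar> < pi / 2"
  shows "(LINT x|lborel. exp (\<theta> * x) * gamma_weight r x) * exp (r * ln (cos \<theta>))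
    = 4 * pi * Gamma r / 2 powr r"
proof -
  define M where "M t = (LINT x|lborel. exp (t * x) * gamma_weight r x)" for t
  let ?g = "\<lambda>t. M t * exp (r * ln (cos t))"
  have "(?g has_real_derivative 0) (at t within {-(pi/2)<..<pi/2})" if t: "t \<in> {-(pi/2)<..<pi/2}" for t
  proof -
    have t': "\<bar>t\<bar> < pi / 2" using t by auto
    have c: "0 < cos t" using t by (intro cos_gt_zero_pi) auto
    have "(LINT x|lborel. x * exp (t * x) * gamma_weight r x) = r * tan t * M t"
      using gamma_weight_tilted_moments(1)[OF r t'] by (simp add: has_bochner_integral_iff M_def)
    then have "(M has_real_derivative r * tan t * M t) (at t)"
      using gamma_weight_mgf_deriv[OF r t'] unfolding M_def[abs_def] by simp
    then have "(?g has_real_derivative 0) (at t)"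
      using c by (auto intro!: derivative_eq_intros simp: tan_def field_simps)
    then show ?thesis by (rule has_field_derivative_at_within)
  qed
  then obtain c where c: "\<And>t. t \<in> {-(pi/2)<..<pi/2} \<Longrightarrow> ?g t = c"
    using has_field_derivative_zero_constant[of "{-(pi/2)<..<pi/2}" ?g] by auto
  have "- (pi / 2) < \<theta>" "\<theta> < pi / 2" using \<theta> by linarith+
  then have "?g \<theta> = ?g 0" using c[of \<theta>] c[of 0] by simp
  also have "\<dots> = 4 * pi * Gamma r / 2 powr r"
    using gamma_weight_integral[OF r] by (simp add: M_def has_bochner_integral_iff)
  finally show ?thesis by (simp add: M_def)
qed

section \<open>The normalised density and its mean and variance\<close>

lemma ghs_density_eq_gamma_weight:
  "ghs_density r \<theta> x = exp (r * ln (cos \<theta>)) * (2 powr (r - 2) / (pi * Gamma r))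
     * (exp (\<theta> * x) * gamma_weight r x)"
proof -
  have "complex_of_real (r / 2) + \<i> * complex_of_real (x / 2) = Complex (r / 2) (x / 2)"
    by (simp add: complex_eq_iff)
  then show ?thesis by (simp add: ghs_density_def gamma_weight_def exp_add)
qed

lemma gamma_weight_pos:
  assumes "0 < r"
  shows "0 < gamma_weight r x"
  using assms nonpos_Ints_Re_pos[of "Complex (r / 2) (x / 2)"]
  by (simp add: gamma_weight_def Gamma_eq_zero_iff)

lemma ghs_density_pos:
  assumes "0 < r"
  shows "0 < ghs_density r \<theta> x"
  unfolding ghs_density_eq_gamma_weight
  using assms gamma_weight_pos[OF assms] by (intro mult_pos_pos divide_pos_pos Gamma_real_pos) auto

lemma gamma_weight_measurable:
  "0 < r \<Longrightarrow> gamma_weight r \<in> borel_measurable borel"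
  by (intro borel_measurable_continuous_onI gamma_weight_continuous)

lemma ghs_density_measurable:
  "0 < r \<Longrightarrow> ghs_density r \<theta> \<in> borel_measurable borel"
  unfolding ghs_density_eq_gamma_weight[abs_def]
  using gamma_weight_measurable[of r] by measurable

lemma ghs_density_moments:
  assumes r: "0 < r" and \<theta>: "\<bar>\<theta>\<bar> < pi / 2"
  shows "has_bochner_integral lborel (ghs_density r \<theta>) 1"
    and "has_bochner_integral lborel (\<lambda>x. ghs_density r \<theta> x * x) (r * tan \<theta>)"
    and "has_bochner_integral lborel (\<lambda>x. ghs_density r \<theta> x * x\<^sup>2) (r + r * (r + 1) * (tan \<theta>)\<^sup>2)"
proof -
  define M where "M = (LINT x|lborel. exp (\<theta> * x) * gamma_weight r x)"
  define c where "c = exp (r * ln (cos \<theta>)) * (2 powr (r - 2) / (pi * Gamma r))"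
  have G: "0 < Gamma r" using r by (rule Gamma_real_pos)
  \<comment> \<open>With the mass 4 pi Gamma r / 2^r the constant 2^(r - 2) / (pi Gamma r) is
    exactly the normalisation.\<close>
  have cM: "c * M = 1"
  proof -
    have "c * M = 2 powr (r - 2) / (pi * Gamma r) * (M * exp (r * ln (cos \<theta>)))"
      by (simp add: c_def)
    also have "\<dots> = 2 powr (r - 2) / (pi * Gamma r) * (4 * pi * Gamma r / 2 powr r)"
      unfolding M_def gamma_weight_mgf[OF r \<theta>] ..
    also have "\<dots> = 1" using G by (simp add: powr_diff)
    finally show ?thesis .
  qed
  have d: "ghs_density r \<theta> x = c * (exp (\<theta> * x) * gamma_weight r x)" for x
    by (simp add: ghs_density_eq_gamma_weight c_def)
  have "has_bochner_integral lborel (\<lambda>x. exp (\<theta> * x) * gamma_weight r x) M"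
    using gamma_weight_tilted_integrable(1)[OF r \<theta>] by (simp add: M_def has_bochner_integral_iff)
  from has_bochner_integral_mult_right[OF this, of c]
  show "has_bochner_integral lborel (ghs_density r \<theta>) 1" unfolding d[abs_def] cM .
  note m = gamma_weight_tilted_moments[OF r \<theta>, folded M_def]
  have "has_bochner_integral lborel (\<lambda>x. ghs_density r \<theta> x * x) (c * (r * tan \<theta> * M))"
    using has_bochner_integral_mult_right[OF m(1), of c] by (simp add: d mult_ac)
  also have "c * (r * tan \<theta> * M) = r * tan \<theta>" using cM by algebra
  finally show "has_bochner_integral lborel (\<lambda>x. ghs_density r \<theta> x * x) (r * tan \<theta>)" .
  have "has_bochner_integral lborel (\<lambda>x. ghs_density r \<theta> x * x\<^sup>2) (c * ((r + r * (r + 1) * (tan \<theta>)\<^sup>2) * M))"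
    using has_bochner_integral_mult_right[OF m(2), of c] by (simp add: d mult_ac)
  also have "c * ((r + r * (r + 1) * (tan \<theta>)\<^sup>2) * M) = r + r * (r + 1) * (tan \<theta>)\<^sup>2" using cM by algebra
  finally show "has_bochner_integral lborel (\<lambda>x. ghs_density r \<theta> x * x\<^sup>2) (r + r * (r + 1) * (tan \<theta>)\<^sup>2)" .
qed

lemma prob_space_ghs_measure:
  assumes "0 < r" "\<bar>\<theta>\<bar> < pi / 2"
  shows "prob_space (ghs_measure r \<theta>)"
proof
  have "(\<integral>\<^sup>+x. ennreal (ghs_density r \<theta> x) \<partial>lborel) = 1"
    using ghs_density_moments(1)[OF assms] ghs_density_pos[OF assms(1), THEN less_imp_le]
    by (subst nn_integral_eq_integral) (auto simp: has_bochner_integral_iff)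
  then show "emeasure (ghs_measure r \<theta>) (space (ghs_measure r \<theta>)) = 1"
    using ghs_density_measurable[OF assms(1)]
    by (simp add: ghs_measure_def emeasure_density)
qed

lemma has_bochner_integral_ghs_measure:
  fixes f :: "real \<Rightarrow> real"
  assumes "0 < r" "f \<in> borel_measurable borel"
    and "has_bochner_integral lborel (\<lambda>x. ghs_density r \<theta> x * f x) I"
  shows "has_bochner_integral (ghs_measure r \<theta>) f I"
  unfolding ghs_measure_def
  using assms ghs_density_measurable[OF assms(1)] ghs_density_pos[OF assms(1), THEN less_imp_le]
  by (intro has_bochner_integral_density) auto

lemma ghs_measure_moments:
  assumes r: "0 < r" and \<theta>: "\<bar>\<theta>\<bar> < pi / 2"
  shows "has_bochner_integral (ghs_measure r \<theta>) (\<lambda>x. x) (r * tan \<theta>)"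
    and "has_bochner_integral (ghs_measure r \<theta>) (\<lambda>x. x\<^sup>2) (r + r * (r + 1) * (tan \<theta>)\<^sup>2)"
  using ghs_density_moments(2,3)[OF assms] by (auto intro!: has_bochner_integral_ghs_measure[OF r])

section \<open>Self-convolution of the weight and moments of the jump kernel\<close>

definition gamma_weight_conv :: "real \<Rightarrow> real \<Rightarrow> real" where
  "gamma_weight_conv r s = (LINT u|lborel. gamma_weight r u * gamma_weight r (s - u))"

lemma gamma_weight_bounded:
  assumes "0 < r"
  obtains B where "0 < B" "\<And>x. gamma_weight r x \<le> B"
  using gamma_weight_decay[OF assms, of 0] by auto

text \<open>The reflected weight is merely bounded by a constant; the decay of the other one already
  dominates a quadratic factor.\<close>

lemma gamma_weight_conv_integrable:
  assumes r: "0 < r" and [measurable]: "p \<in> borel_measurable borel"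
    and p: "\<And>u. \<bar>p u\<bar> \<le> c + K * u\<^sup>2" and c: "0 \<le> c" "0 \<le> K"
  shows "integrable lborel (\<lambda>u. p u * (gamma_weight r u * gamma_weight r (s - u)))"
proof -
  obtain B where B: "0 < B" "\<And>x. gamma_weight r x \<le> B" using gamma_weight_bounded[OF r] by blast
  define \<kappa> :: real where "\<kappa> = 1 / 2"
  have \<kappa>: "0 < \<kappa>" "\<kappa> < pi / 2" using pi_ge_two unfolding \<kappa>_def by linarith+
  obtain D where D: "\<And>x. 1 + x\<^sup>2 \<le> D * exp (\<kappa> * \<bar>x\<bar>)"
    using square_le_exp[of 1 \<kappa>] \<kappa>(1) by auto
  note [measurable] = gamma_weight_measurable[OF r]
  have "integrable lborel (\<lambda>u. p u * gamma_weight r (s - u) * gamma_weight r u)"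
  proof (rule integrable_mult_gamma_weight[OF r _ \<kappa>(2)])
    fix u
    have "\<bar>p u * gamma_weight r (s - u)\<bar> \<le> ((c + K) * (1 + u\<^sup>2)) * B"
      unfolding abs_mult using p[of u] B(1) B(2)[of "s - u"] c
      by (intro mult_mono) (auto simp: gamma_weight_def algebra_simps intro: order_trans add_increasing)
    also have "\<dots> \<le> ((c + K) * (D * exp (\<kappa> * \<bar>u\<bar>))) * B"
      using B(1) c by (intro mult_right_mono mult_left_mono D) auto
    finally show "\<bar>p u * gamma_weight r (s - u)\<bar> \<le> ((c + K) * D * B) * exp (\<kappa> * \<bar>u\<bar>)"
      by (simp add: mult_ac)
  qed simp
  then show ?thesis by (simp add: mult_ac)
qed

text \<open>A vanishing integral of a strictly positive function would make the whole line a null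
  set. Positivity is what permits division by the normalisation of q.\<close>

lemma gamma_weight_conv_pos:
  assumes r: "0 < r"
  shows "0 < gamma_weight_conv r s"
proof -
  let ?f = "\<lambda>u. gamma_weight r u * gamma_weight r (s - u)"
  have pos: "0 < ?f u" for u using gamma_weight_pos[OF r] by simp
  have int: "integrable lborel ?f"
    using gamma_weight_conv_integrable[OF r, of "\<lambda>_. 1" 1 0 s] by simp
  have "gamma_weight_conv r s \<noteq> 0"
  proof
    assume "gamma_weight_conv r s = 0"
    then have "AE u in lborel. ?f u = 0"
      unfolding gamma_weight_conv_def
      using integral_nonneg_eq_0_iff_AE[OF int] pos[THEN less_imp_le] by auto
    then have "AE u in (lborel :: real measure). False"
      using pos by (auto elim!: eventually_mono simp: less_le)
    then obtain N where "UNIV \<subseteq> N" "emeasure (lborel :: real measure) N = 0"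
      by (auto elim: AE_E)
    then show False using top.extremum_unique[of N] by simp
  qed
  moreover have "0 \<le> gamma_weight_conv r s"
    unfolding gamma_weight_conv_def using pos[THEN less_imp_le]
    by (intro Bochner_Integration.integral_nonneg)
  ultimately show ?thesis by simp
qed

text \<open>In the contour shift for the second moment both weights start at parameter r + 1 and
  both drop to r. The prefactor z - s/2 raises the degree: without it the same shift would only say
  once more that the centred first moment is zero.\<close>

lemma gamma_weight_conv_moments:
  assumes r: "0 < r"
  shows "has_bochner_integral lborel (\<lambda>u. gamma_weight r u * gamma_weight r (s - u)) (gamma_weight_conv r s)"
    and "has_bochner_integral lborel
      (\<lambda>u. (u - s / 2) * (gamma_weight r u * gamma_weight r (s - u))) 0"
    and "has_bochner_integral lborel
      (\<lambda>u. (u - s / 2)\<^sup>2 * (gamma_weight r u * gamma_weight r (s - u)))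
      ((r\<^sup>2 + s\<^sup>2 / 4) / (2 * r + 1) * gamma_weight_conv r s)"
proof -
  let ?w = "\<lambda>u. gamma_weight r u * gamma_weight r (s - u)"
  have int0: "integrable lborel ?w"
    using gamma_weight_conv_integrable[OF r, of "\<lambda>_. 1" 1 0 s] by simp
  then show "has_bochner_integral lborel ?w (gamma_weight_conv r s)"
    by (simp add: gamma_weight_conv_def has_bochner_integral_iff)
  have int1: "integrable lborel (\<lambda>u. (u - s / 2) * ?w u)"
  proof (rule gamma_weight_conv_integrable[OF r])
    show "\<bar>u - s / 2\<bar> \<le> (1 + \<bar>s\<bar> / 2) + 1 * u\<^sup>2" for u
      using abs_le_1_plus_square[of u] by (simp add: abs_if split: if_splits)
  qed auto
  have int2: "integrable lborel (\<lambda>u. (u - s / 2)\<^sup>2 * ?w u)"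
  proof (rule gamma_weight_conv_integrable[OF r])
    show "\<bar>(u - s / 2)\<^sup>2\<bar> \<le> s\<^sup>2 / 2 + 2 * u\<^sup>2" for u
    proof -
      have "(u - s / 2)\<^sup>2 \<le> s\<^sup>2 / 2 + 2 * u\<^sup>2"
        using zero_le_power2[of "u + s / 2"] by (simp add: power2_eq_square algebra_simps)
      then show ?thesis by simp
    qed
  qed auto
  \<comment> \<open>Under the reflection u to s - u the product of weights is invariant and u - s/2
    changes sign.\<close>
  have "(LINT u|lborel. (u - s / 2) * ?w u) = (LINT u|lborel. (s + (-1) * u - s / 2) * ?w (s + (-1) * u))"
    by (subst lborel_integral_real_affine[where c = "-1" and t = s]) auto
  also have "\<dots> = (LINT u|lborel. - ((u - s / 2) * ?w u))"
    by (intro Bochner_Integration.integral_cong refl) (simp add: algebra_simps)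
  also have "\<dots> = - (LINT u|lborel. (u - s / 2) * ?w u)" by simp
  finally show "has_bochner_integral lborel (\<lambda>u. (u - s / 2) * ?w u) 0"
    using int1 by (simp add: has_bochner_integral_iff)

  \<comment> \<open>Rate 0 is enough: \<open>gamma_weight_shift\<close> brings its own decaying
    weight, so the reflected factor inside the test function only has to be bounded for heights |t|
    \<le> 1.\<close>
  obtain C where C: "0 < C"
    "\<And>x t. \<bar>t\<bar> \<le> 1 \<Longrightarrow> cmod (gamma_weight_complex (r + 1) (Complex x t)) \<le> C"
    using gamma_weight_complex_bound[OF r, of 0] by auto
  define \<kappa> :: real where "\<kappa> = 1 / 2"
  have \<kappa>: "0 < \<kappa>" "\<kappa> < pi / 2" using pi_ge_two unfolding \<kappa>_def by linarith+
  obtain D where D: "0 < D" "\<And>x. (2 + \<bar>s\<bar> / 2) + x\<^sup>2 \<le> D * exp (\<kappa> * \<bar>x\<bar>)"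
    using square_le_exp[of "2 + \<bar>s\<bar> / 2" \<kappa>] \<kappa>(1) by auto
  let ?E = "\<lambda>z. (z - of_real (s / 2)) * gamma_weight_complex (r + 1) (of_real s - z)"
  have E1: "?E (Complex x 1) = Complex (x - s / 2) 1 * (Complex r (s - x) / 2 * gamma_weight r (s - x))" for x
  proof -
    have "of_real s - Complex x 1 = Complex (s - x) (-1)" "Complex x 1 - of_real (s / 2) = Complex (x - s / 2) 1"
      by (simp_all add: complex_eq_iff)
    then show ?thesis by (simp only: gamma_weight_complex_shift[OF r])
  qed
  have E2: "?E (Complex x (-1)) = Complex (x - s / 2) (-1) * (Complex r (x - s) / 2 * gamma_weight r (s - x))" for x
  proof -
    have "of_real s - Complex x (-1) = Complex (s - x) 1" "Complex x (-1) - of_real (s / 2) = Complex (x - s / 2) (-1)"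
      by (simp_all add: complex_eq_iff)
    then show ?thesis by (simp only: gamma_weight_complex_shift[OF r] minus_diff_eq)
  qed
  have "has_bochner_integral lborel
    (\<lambda>x. Im (?E (Complex x 1) * Complex r (- x)) * gamma_weight r x) 0"
  proof (rule gamma_weight_shift[OF r _ \<kappa>(2)])
    show "?E holomorphic_on {z. \<bar>Im z\<bar> < r + 1}"
    proof (intro holomorphic_intros)
      have "(gamma_weight_complex (r + 1) \<circ> (\<lambda>z. of_real s - z)) holomorphic_on {z. \<bar>Im z\<bar> < r + 1}"
        by (intro holomorphic_on_compose_gen[OF _ gamma_weight_complex_holomorphic[of "r + 1"]] holomorphic_intros)
           auto
      then show "(\<lambda>z. gamma_weight_complex (r + 1) (of_real s - z)) holomorphic_on {z. \<bar>Im z\<bar> < r + 1}"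
        by (simp add: o_def)
    qed
    show "cmod (?E (Complex x t)) \<le> (D * C) * exp (\<kappa> * \<bar>x\<bar>)" if t: "\<bar>t\<bar> \<le> 1" for x t
    proof -
      have "cmod (Complex x t - of_real (s / 2)) \<le> \<bar>x - s / 2\<bar> + \<bar>t\<bar>"
        using cmod_le[of "Complex x t - of_real (s / 2)"] by simp
      also have "\<dots> \<le> (2 + \<bar>s\<bar> / 2) + x\<^sup>2"
        using t abs_le_1_plus_square[of x] by (simp add: abs_if split: if_splits)
      also note D(2)[of x]
      finally have 1: "cmod (Complex x t - of_real (s / 2)) \<le> D * exp (\<kappa> * \<bar>x\<bar>)" .
      have "of_real s - Complex x t = Complex (s - x) (- t)" by (simp add: complex_eq_iff)
      then have 2: "cmod (gamma_weight_complex (r + 1) (of_real s - Complex x t)) \<le> C"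
        using C(2)[of "- t" "s - x"] t by simp
      have "cmod (?E (Complex x t)) \<le> (D * exp (\<kappa> * \<bar>x\<bar>)) * C"
        unfolding norm_mult using D(1) by (intro mult_mono 1 2) auto
      then show ?thesis by (simp add: mult_ac)
    qed
    show "?E (Complex x (- 1)) = cnj (?E (Complex x 1))" for x
      unfolding E1 E2 by (simp add: complex_eq_iff algebra_simps)
  qed
  then have "has_bochner_integral lborel (\<lambda>u. (r\<^sup>2 + s\<^sup>2 / 4) / 2 * ?w u - (2 * r + 1) / 2 * ((u - s / 2)\<^sup>2 * ?w u)) 0"
  proof (rule has_bochner_integral_cong[THEN iffD1, rotated -1])
    fix x
    \<comment> \<open>With v = x - s/2 the two linear factors multiply to r^2 + s^2/4 - v^2 - 2 i r
      v; the factor v + i then contributes the further term -2 r v^2 to the imaginary part, whence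
      the 2 r + 1.\<close>
    have "Im (Complex (x - s / 2) 1 * Complex r (s - x) * Complex r (- x))
        = (r\<^sup>2 + s\<^sup>2 / 4) - (2 * r + 1) * (x - s / 2)\<^sup>2"
      by (simp add: power2_eq_square field_simps)
    moreover have "?E (Complex x 1) * Complex r (- x)
        = (Complex (x - s / 2) 1 * Complex r (s - x) * Complex r (- x)) * of_real (gamma_weight r (s - x) / 2)"
      unfolding E1 by simp
    moreover have "Im (z * of_real a) = Im z * a" for z a by simp
    ultimately have Im_eq: "Im (?E (Complex x 1) * Complex r (- x))
        = ((r\<^sup>2 + s\<^sup>2 / 4) - (2 * r + 1) * (x - s / 2)\<^sup>2) * (gamma_weight r (s - x) / 2)"
      by (simp only:)
    then show "Im (?E (Complex x 1) * Complex r (- x)) * gamma_weight r x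
        = (r\<^sup>2 + s\<^sup>2 / 4) / 2 * ?w x - (2 * r + 1) / 2 * ((x - s / 2)\<^sup>2 * ?w x)"
      unfolding Im_eq by (simp add: field_simps)
  qed auto
  then have "(r\<^sup>2 + s\<^sup>2 / 4) / 2 * gamma_weight_conv r s
      - (2 * r + 1) / 2 * (LINT u|lborel. (u - s / 2)\<^sup>2 * ?w u) = 0"
    using int0 int2 by (simp add: has_bochner_integral_iff gamma_weight_conv_def)
  then have "(LINT u|lborel. (u - s / 2)\<^sup>2 * ?w u) = (r\<^sup>2 + s\<^sup>2 / 4) / (2 * r + 1) * gamma_weight_conv r s"
    using r by (simp add: field_simps)
  then show "has_bochner_integral lborel (\<lambda>u. (u - s / 2)\<^sup>2 * ?w u)
      ((r\<^sup>2 + s\<^sup>2 / 4) / (2 * r + 1) * gamma_weight_conv r s)"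
    using int2 by (simp add: has_bochner_integral_iff)
qed

text \<open>A jump conserves x + y, so the two tilts multiply to a factor constant in \<alpha>. What
  remains is free of \<theta>, with a denominator depending only on the sum.\<close>

lemma ghs_q_eq_gamma_weight:
  assumes r: "0 < r"
  shows "ghs_q r \<theta> \<alpha> x y
    = gamma_weight r (x - \<alpha>) * gamma_weight r (y + \<alpha>) / gamma_weight_conv r (x + y)"
proof -
  define c where "c = (exp (r * ln (cos \<theta>)) * (2 powr (r - 2) / (pi * Gamma r)))\<^sup>2 * exp (\<theta> * (x + y))"
  have c: "c \<noteq> 0" using Gamma_real_pos[OF r] by (simp add: c_def)
  have pp: "ghs_density r \<theta> (x - \<alpha>) * ghs_density r \<theta> (y + \<alpha>)
      = c * (gamma_weight r (x - \<alpha>) * gamma_weight r (y + \<alpha>))" for \<alpha>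
  proof -
    have "exp (\<theta> * (x + y)) = exp (\<theta> * (x - \<alpha>)) * exp (\<theta> * (y + \<alpha>))"
      by (simp add: exp_add[symmetric] algebra_simps)
    then show ?thesis by (simp add: ghs_density_eq_gamma_weight c_def power2_eq_square)
  qed
  have "(LINT \<alpha>|lborel. gamma_weight r (x - \<alpha>) * gamma_weight r (y + \<alpha>)) = gamma_weight_conv r (x + y)"
    unfolding gamma_weight_conv_def
    by (subst (2) lborel_integral_real_affine[where c = "-1" and t = x]) (auto simp: add.commute)
  then have "ghs_Z r \<theta> x y = c * gamma_weight_conv r (x + y)"
    unfolding ghs_Z_def pp by simp
  then show ?thesis using c by (simp add: ghs_q_def pp)
qed

text \<open>The variable u = x - \<alpha> is the value at the first site after the jump; then y +
  \<alpha> = x + y - u, and moments of q become moments of the convolution integrand with fixed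
  sum.\<close>

lemma has_bochner_integral_ghs_q:
  fixes f :: "real \<Rightarrow> real"
  assumes r: "0 < r"
    and "has_bochner_integral lborel (\<lambda>u. f u * (gamma_weight r u * gamma_weight r (x + y - u)))
      (I * gamma_weight_conv r (x + y))"
  shows "has_bochner_integral lborel (\<lambda>\<alpha>. f (x - \<alpha>) * ghs_q r \<theta> \<alpha> x y) I"
proof -
  let ?W = "gamma_weight_conv r (x + y)"
  have "has_bochner_integral lborel (\<lambda>\<alpha>. f (x + (-1) * \<alpha>)
      * (gamma_weight r (x + (-1) * \<alpha>) * gamma_weight r (x + y - (x + (-1) * \<alpha>)))) ((I * ?W) /\<^sub>R \<bar>-1\<bar>)"
    using lborel_has_bochner_integral_real_affine_iff[where c = "-1" and t = x, THEN iffD1, OF _ assms(2)] by simp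
  from has_bochner_integral_mult_left[OF this, of "1 / ?W"]
  show ?thesis
    using gamma_weight_conv_pos[OF r, of "x + y"] by (simp add: ghs_q_eq_gamma_weight[OF r])
qed

text \<open>With s = x + y the jump is \<alpha> = (x - y)/2 - (u - s/2). The centred first moment
  vanishes, so the mean is (x - y)/2 and the second moment is its square plus the centred second
  moment.\<close>

lemma ghs_q_moments:
  assumes r: "0 < r"
  shows "has_bochner_integral lborel (\<lambda>\<alpha>. ghs_q r \<theta> \<alpha> x y) 1"
    and "has_bochner_integral lborel (\<lambda>\<alpha>. \<alpha> * ghs_q r \<theta> \<alpha> x y) ((x - y) / 2)"
    and "has_bochner_integral lborel (\<lambda>\<alpha>. \<alpha>\<^sup>2 * ghs_q r \<theta> \<alpha> x y)
      ((x - y)\<^sup>2 / 4 + (r\<^sup>2 + (x + y)\<^sup>2 / 4) / (2 * r + 1))"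
proof -
  let ?s = "x + y"
  note m = gamma_weight_conv_moments[OF r, of ?s]
  show "has_bochner_integral lborel (\<lambda>\<alpha>. ghs_q r \<theta> \<alpha> x y) 1"
    using has_bochner_integral_ghs_q[OF r, of "\<lambda>_. 1" x y 1 \<theta>] m(1) by simp
  have "has_bochner_integral lborel (\<lambda>u. (x - y) / 2 * (gamma_weight r u * gamma_weight r (?s - u))
      - (u - ?s / 2) * (gamma_weight r u * gamma_weight r (?s - u)))
      ((x - y) / 2 * gamma_weight_conv r ?s - 0)"
    by (intro has_bochner_integral_diff has_bochner_integral_mult_right m)
  then have "has_bochner_integral lborel (\<lambda>u. (x - u) * (gamma_weight r u * gamma_weight r (?s - u)))
      ((x - y) / 2 * gamma_weight_conv r ?s)"
    by (rule has_bochner_integral_cong[THEN iffD1, rotated -1]) (auto simp: field_simps)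
  from has_bochner_integral_ghs_q[OF r this, of \<theta>]
  show "has_bochner_integral lborel (\<lambda>\<alpha>. \<alpha> * ghs_q r \<theta> \<alpha> x y) ((x - y) / 2)" by simp
  have "has_bochner_integral lborel (\<lambda>u. (x - y)\<^sup>2 / 4 * (gamma_weight r u * gamma_weight r (?s - u))
      - (x - y) * ((u - ?s / 2) * (gamma_weight r u * gamma_weight r (?s - u)))
      + (u - ?s / 2)\<^sup>2 * (gamma_weight r u * gamma_weight r (?s - u)))
      ((x - y)\<^sup>2 / 4 * gamma_weight_conv r ?s - (x - y) * 0 + (r\<^sup>2 + ?s\<^sup>2 / 4) / (2 * r + 1) * gamma_weight_conv r ?s)"
    by (intro has_bochner_integral_diff has_bochner_integral_add has_bochner_integral_mult_right m)
  also have "(x - y)\<^sup>2 / 4 * gamma_weight_conv r ?s - (x - y) * 0 + (r\<^sup>2 + ?s\<^sup>2 / 4) / (2 * r + 1) * gamma_weight_conv r ?s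
     = ((x - y)\<^sup>2 / 4 + (r\<^sup>2 + ?s\<^sup>2 / 4) / (2 * r + 1)) * gamma_weight_conv r ?s"
    by (simp add: distrib_right)
  also have "(\<lambda>u. (x - y)\<^sup>2 / 4 * (gamma_weight r u * gamma_weight r (?s - u))
      - (x - y) * ((u - ?s / 2) * (gamma_weight r u * gamma_weight r (?s - u)))
      + (u - ?s / 2)\<^sup>2 * (gamma_weight r u * gamma_weight r (?s - u)))
      = (\<lambda>u. (x - u)\<^sup>2 * (gamma_weight r u * gamma_weight r (?s - u)))"
  proof
    fix u
    have *: "(x - y)\<^sup>2 / 4 - (x - y) * (u - ?s / 2) + (u - ?s / 2)\<^sup>2 = (x - u)\<^sup>2"
      by (simp add: power2_eq_square field_simps)
    show "(x - y)\<^sup>2 / 4 * (gamma_weight r u * gamma_weight r (?s - u))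
      - (x - y) * ((u - ?s / 2) * (gamma_weight r u * gamma_weight r (?s - u)))
      + (u - ?s / 2)\<^sup>2 * (gamma_weight r u * gamma_weight r (?s - u))
      = (x - u)\<^sup>2 * (gamma_weight r u * gamma_weight r (?s - u))"
      unfolding *[symmetric] by (simp only: distrib_right left_diff_distrib mult.assoc)
  qed
  finally show "has_bochner_integral lborel (\<lambda>\<alpha>. \<alpha>\<^sup>2 * ghs_q r \<theta> \<alpha> x y)
      ((x - y)\<^sup>2 / 4 + (r\<^sup>2 + (x + y)\<^sup>2 / 4) / (2 * r + 1))"
    using has_bochner_integral_ghs_q[OF r, of "\<lambda>u. (x - u)\<^sup>2" x y _ \<theta>] by simp
qed

section \<open>Invariance\<close>

lemma ghs_q_measurable:
  assumes r: "0 < r" and [measurable]: "f \<in> borel_measurable M" "g \<in> borel_measurable M" "h \<in> borel_measurable M"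
  shows "(\<lambda>\<omega>. ghs_q r \<theta> (f \<omega>) (g \<omega>) (h \<omega>)) \<in> borel_measurable M"
proof -
  note [measurable] = gamma_weight_measurable[OF r]
  have [measurable]: "gamma_weight_conv r \<in> borel_measurable borel"
    unfolding gamma_weight_conv_def[abs_def] by measurable
  show ?thesis unfolding ghs_q_eq_gamma_weight[OF r] by measurable
qed

lemma ghs_q_nonneg:
  assumes r: "0 < r"
  shows "0 \<le> ghs_q r \<theta> \<alpha> x y"
  unfolding ghs_q_eq_gamma_weight[OF r] using gamma_weight_conv_pos[OF r, THEN less_imp_le]
  by (intro divide_nonneg_nonneg mult_nonneg_nonneg) (auto simp: gamma_weight_def)

lemma nn_integral_ghs_q:
  assumes "0 < r"
  shows "(\<integral>\<^sup>+\<alpha>. ennreal (ghs_q r \<theta> \<alpha> x y) \<partial>lborel) = 1"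
  using ghs_q_moments(1)[OF assms] ghs_q_nonneg[OF assms]
  by (subst nn_integral_eq_integral) (auto simp: has_bochner_integral_iff)

text \<open>Both sides have the same four densities in the numerator and, the sum being conserved,
  the same normalisation. The reverse jump has the same \<alpha> because the two sites are listed in
  exchanged order.\<close>

lemma ghs_detailed_balance:
  "ghs_q r \<theta> \<alpha> x y * ghs_density r \<theta> x * ghs_density r \<theta> y =
     ghs_q r \<theta> \<alpha> (y + \<alpha>) (x - \<alpha>) * ghs_density r \<theta> (x - \<alpha>) * ghs_density r \<theta> (y + \<alpha>)"
proof -
  have "ghs_Z r \<theta> (y + \<alpha>) (x - \<alpha>) = ghs_Z r \<theta> x y" by (rule ghs_Z_sum) simp
  then show ?thesis by (simp add: ghs_q_def)
qed

text \<open>For a fixed jump \<alpha> the translation a to a + \<alpha>, b to b - \<alpha> undoes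
  the jump inside \<open>G\<close>. Detailed balance then exchanges the arguments of q, and in
  either order its integral over \<alpha> is 1. Values in \<open>ennreal\<close> make Tonelli
  available without integrability conditions.\<close>

lemma ghs_two_site_invariance:
  fixes G :: "real \<times> real \<Rightarrow> ennreal"
  assumes r: "0 < r" and [measurable]: "G \<in> borel_measurable (borel \<Otimes>\<^sub>M borel)"
  shows "(\<integral>\<^sup>+b. (\<integral>\<^sup>+a. (\<integral>\<^sup>+\<alpha>. ennreal (ghs_q r \<theta> \<alpha> a b) * G (a - \<alpha>, b + \<alpha>) \<partial>lborel)
      \<partial>(ghs_measure r \<theta>)) \<partial>(ghs_measure r \<theta>))
    = (\<integral>\<^sup>+b. (\<integral>\<^sup>+a. G (a, b) \<partial>(ghs_measure r \<theta>)) \<partial>(ghs_measure r \<theta>))"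
proof -
  define P where "P a = ennreal (ghs_density r \<theta> a)" for a
  let ?Q = "\<lambda>\<alpha> a b. ennreal (ghs_q r \<theta> \<alpha> a b)"
  note [measurable] = ghs_density_measurable[OF r] ghs_q_measurable[OF r]
  have [measurable]: "P \<in> borel_measurable borel" unfolding P_def[abs_def] by measurable
  have M: "(\<integral>\<^sup>+a. f a \<partial>(ghs_measure r \<theta>)) = (\<integral>\<^sup>+a. P a * f a \<partial>lborel)"
    if [measurable]: "f \<in> borel_measurable borel" for f
    unfolding ghs_measure_def P_def by (subst nn_integral_density) auto
  \<comment> \<open>Tonelli makes \<alpha> the outermost variable, so that the translations are by a
    constant.\<close>
  have rotate: "(\<integral>\<^sup>+b. (\<integral>\<^sup>+a. (\<integral>\<^sup>+\<alpha>. X (\<alpha>, a, b) \<partial>lborel) \<partial>lborel) \<partial>lborel)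
      = (\<integral>\<^sup>+\<alpha>. (\<integral>\<^sup>+b. (\<integral>\<^sup>+a. X (\<alpha>, a, b) \<partial>lborel) \<partial>lborel) \<partial>lborel)"
    if [measurable]: "X \<in> borel_measurable (borel \<Otimes>\<^sub>M borel \<Otimes>\<^sub>M borel)"
    for X :: "real \<times> real \<times> real \<Rightarrow> ennreal"
  proof -
    have "(\<integral>\<^sup>+b. (\<integral>\<^sup>+a. (\<integral>\<^sup>+\<alpha>. X (\<alpha>, a, b) \<partial>lborel) \<partial>lborel) \<partial>lborel)
        = (\<integral>\<^sup>+b. (\<integral>\<^sup>+\<alpha>. (\<integral>\<^sup>+a. X (\<alpha>, a, b) \<partial>lborel) \<partial>lborel) \<partial>lborel)"
      by (rule nn_integral_cong, rule lborel_pair.Fubini') measurable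
    also have "\<dots> = (\<integral>\<^sup>+\<alpha>. (\<integral>\<^sup>+b. (\<integral>\<^sup>+a. X (\<alpha>, a, b) \<partial>lborel) \<partial>lborel) \<partial>lborel)"
      by (rule lborel_pair.Fubini') measurable
    finally show ?thesis .
  qed
  \<comment> \<open>Detailed balance read at the state (a + \<alpha>, b - \<alpha>) before the
    jump.\<close>
  have balance: "P (b - \<alpha>) * (P (a + \<alpha>) * ?Q \<alpha> (a + \<alpha>) (b - \<alpha>)) = P b * (P a * ?Q \<alpha> b a)" for \<alpha> a b
    using ghs_detailed_balance[of r \<theta> \<alpha> "a + \<alpha>" "b - \<alpha>"]
      ghs_density_pos[OF r, THEN less_imp_le] ghs_q_nonneg[OF r]
    by (simp add: P_def ennreal_mult[symmetric] mult_ac)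
  have "(\<integral>\<^sup>+b. (\<integral>\<^sup>+a. (\<integral>\<^sup>+\<alpha>. ?Q \<alpha> a b * G (a - \<alpha>, b + \<alpha>) \<partial>lborel)
      \<partial>(ghs_measure r \<theta>)) \<partial>(ghs_measure r \<theta>))
    = (\<integral>\<^sup>+b. (\<integral>\<^sup>+a. (\<integral>\<^sup>+\<alpha>. P b * (P a * (?Q \<alpha> a b * G (a - \<alpha>, b + \<alpha>))) \<partial>lborel) \<partial>lborel) \<partial>lborel)"
    by (simp add: M nn_integral_cmult)
  also have "\<dots> = (\<integral>\<^sup>+\<alpha>. (\<integral>\<^sup>+b. (\<integral>\<^sup>+a. P b * (P a * (?Q \<alpha> a b * G (a - \<alpha>, b + \<alpha>))) \<partial>lborel) \<partial>lborel) \<partial>lborel)"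
    using rotate[of "\<lambda>(\<alpha>, a, b). P b * (P a * (?Q \<alpha> a b * G (a - \<alpha>, b + \<alpha>)))"] by simp
  also have "\<dots> = (\<integral>\<^sup>+\<alpha>. (\<integral>\<^sup>+b. (\<integral>\<^sup>+a. P b * (P a * (?Q \<alpha> b a * G (a, b))) \<partial>lborel) \<partial>lborel) \<partial>lborel)"
  proof (rule nn_integral_cong)
    fix \<alpha> :: real
    have "(\<integral>\<^sup>+b. (\<integral>\<^sup>+a. P b * (P a * (?Q \<alpha> a b * G (a - \<alpha>, b + \<alpha>))) \<partial>lborel) \<partial>lborel)
        = (\<integral>\<^sup>+b. (\<integral>\<^sup>+a. P b * (P (\<alpha> + 1 * a) * (?Q \<alpha> (\<alpha> + 1 * a) b * G (\<alpha> + 1 * a - \<alpha>, b + \<alpha>))) \<partial>lborel) \<partial>lborel)"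
    proof (rule nn_integral_cong)
      fix b
      show "(\<integral>\<^sup>+a. P b * (P a * (?Q \<alpha> a b * G (a - \<alpha>, b + \<alpha>))) \<partial>lborel)
          = (\<integral>\<^sup>+a. P b * (P (\<alpha> + 1 * a) * (?Q \<alpha> (\<alpha> + 1 * a) b * G (\<alpha> + 1 * a - \<alpha>, b + \<alpha>))) \<partial>lborel)"
        by (subst nn_integral_real_affine[where c = 1 and t = \<alpha>]) auto
    qed
    also have "\<dots> = (\<integral>\<^sup>+b. (\<integral>\<^sup>+a. P (- \<alpha> + 1 * b) * (P (\<alpha> + 1 * a) * (?Q \<alpha> (\<alpha> + 1 * a) (- \<alpha> + 1 * b)
        * G (\<alpha> + 1 * a - \<alpha>, - \<alpha> + 1 * b + \<alpha>))) \<partial>lborel) \<partial>lborel)"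
      by (subst nn_integral_real_affine[where c = 1 and t = "- \<alpha>"]) auto
    also have "\<dots> = (\<integral>\<^sup>+b. (\<integral>\<^sup>+a. P b * (P a * (?Q \<alpha> b a * G (a, b))) \<partial>lborel) \<partial>lborel)"
    proof (intro nn_integral_cong)
      fix a b
      show "P (- \<alpha> + 1 * b) * (P (\<alpha> + 1 * a) * (?Q \<alpha> (\<alpha> + 1 * a) (- \<alpha> + 1 * b)
          * G (\<alpha> + 1 * a - \<alpha>, - \<alpha> + 1 * b + \<alpha>))) = P b * (P a * (?Q \<alpha> b a * G (a, b)))"
        using arg_cong[OF balance[of b \<alpha> a], of "\<lambda>z. z * G (a, b)"]
        by (simp add: add.commute mult.assoc)
    qed
    finally show "(\<integral>\<^sup>+b. (\<integral>\<^sup>+a. P b * (P a * (?Q \<alpha> a b * G (a - \<alpha>, b + \<alpha>))) \<partial>lborel) \<partial>lborel)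
        = (\<integral>\<^sup>+b. (\<integral>\<^sup>+a. P b * (P a * (?Q \<alpha> b a * G (a, b))) \<partial>lborel) \<partial>lborel)" .
  qed
  also have "\<dots> = (\<integral>\<^sup>+b. (\<integral>\<^sup>+a. (\<integral>\<^sup>+\<alpha>. P b * (P a * (?Q \<alpha> b a * G (a, b))) \<partial>lborel) \<partial>lborel) \<partial>lborel)"
    using rotate[of "\<lambda>(\<alpha>, a, b). P b * (P a * (?Q \<alpha> b a * G (a, b)))"] by simp
  also have "\<dots> = (\<integral>\<^sup>+b. (\<integral>\<^sup>+a. P b * (P a * G (a, b)) \<partial>lborel) \<partial>lborel)"
    by (simp add: nn_integral_cmult nn_integral_multc nn_integral_ghs_q[OF r])
  also have "\<dots> = (\<integral>\<^sup>+b. (\<integral>\<^sup>+a. G (a, b) \<partial>(ghs_measure r \<theta>)) \<partial>(ghs_measure r \<theta>))"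
    by (simp add: M nn_integral_cmult)
  finally show ?thesis .
qed

section \<open>From two sites to the product measure on the torus\<close>

lemma sets_nu_GHS: "sets (nu_GHS r \<theta> N) = sets (config_space N)"
  unfolding nu_GHS_def config_space_def by (intro sets_PiM_cong) (auto simp: ghs_measure_def)

lemma space_nu_GHS: "space (nu_GHS r \<theta> N) = space (config_space N)"
  using sets_nu_GHS by (rule sets_eq_imp_space_eq)

lemma prob_space_nu_GHS:
  assumes "0 < r" "\<bar>\<theta>\<bar> < pi / 2"
  shows "prob_space (nu_GHS r \<theta> N)"
  unfolding nu_GHS_def using prob_space_ghs_measure[OF assms] by (intro prob_space_PiM)

lemma coordinate_measurable:
  "x < N \<Longrightarrow> (\<lambda>\<eta>. \<eta> x) \<in> borel_measurable (config_space N)"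
  unfolding config_space_def by (rule measurable_component_singleton) simp

lemma transfer_measurable:
  assumes "x < N" "y < N"
  shows "(\<lambda>(\<eta>, \<alpha>). transfer x y \<alpha> \<eta>) \<in> config_space N \<Otimes>\<^sub>M borel \<rightarrow>\<^sub>M config_space N"
proof -
  note [measurable] = coordinate_measurable
  have "(\<lambda>\<omega> z. fst \<omega> z - snd \<omega> * delta x z + snd \<omega> * delta y z)
      \<in> config_space N \<Otimes>\<^sub>M borel \<rightarrow>\<^sub>M (\<Pi>\<^sub>M x\<in>{..<N}. borel)"
  proof (rule measurable_PiM_single')
    show "(\<lambda>\<omega>. fst \<omega> z - snd \<omega> * delta x z + snd \<omega> * delta y z) \<in> borel_measurable (config_space N \<Otimes>\<^sub>M borel)"
      if "z \<in> {..<N}" for z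
      using that by (intro borel_measurable_add borel_measurable_diff borel_measurable_times
          measurable_compose[OF measurable_fst] measurable_snd coordinate_measurable) auto
    \<comment> \<open>Outside \<open>{..<N}\<close> both \<open>delta\<close> terms are 0, so the
      value \<open>undefined\<close> is preserved and the result stays extensional.\<close>
    show "(\<lambda>\<omega> z. fst \<omega> z - snd \<omega> * delta x z + snd \<omega> * delta y z)
        \<in> space (config_space N \<Otimes>\<^sub>M borel) \<rightarrow> {..<N} \<rightarrow>\<^sub>E space borel"
      using assms by (auto simp: config_space_def space_pair_measure space_PiM delta_def PiE_iff extensional_def)
  qed
  then show ?thesis by (simp add: transfer_def config_space_def case_prod_beta)
qed

lemma transfer_in_space:
  assumes "x < N" "y < N" "\<eta> \<in> space (config_space N)"
  shows "transfer x y \<alpha> \<eta> \<in> space (config_space N)"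
  using measurable_space[OF transfer_measurable[OF assms(1,2)], of "(\<eta>, \<alpha>)"] assms(3)
  by (simp add: space_pair_measure)

text \<open>The coordinates x and y are integrated innermost with all others frozen; the jump does
  not touch the others, so two-site invariance applies to each section of \<open>g\<close>.\<close>

lemma nn_integral_transfer:
  fixes g :: "(nat \<Rightarrow> real) \<Rightarrow> ennreal"
  assumes r: "0 < r" and \<theta>: "\<bar>\<theta>\<bar> < pi / 2" and xy: "x < N" "y < N" "x \<noteq> y"
    and g: "g \<in> borel_measurable (config_space N)"
  shows "(\<integral>\<^sup>+\<eta>. (\<integral>\<^sup>+\<alpha>. ennreal (ghs_q r \<theta> \<alpha> (\<eta> x) (\<eta> y)) * g (transfer x y \<alpha> \<eta>) \<partial>lborel) \<partial>(nu_GHS r \<theta> N))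
    = (\<integral>\<^sup>+\<eta>. g \<eta> \<partial>(nu_GHS r \<theta> N))"
proof -
  let ?M = "\<lambda>_::nat. ghs_measure r \<theta>"
  interpret product_sigma_finite ?M
    using prob_space_ghs_measure[OF r \<theta>]
    by (simp add: product_sigma_finite_def prob_space_imp_sigma_finite)
  define J where "J = {..<N} - {x, y}"
  have J: "finite J" "y \<notin> J" "x \<notin> insert y J" "{..<N} = insert x (insert y J)"
    using xy by (auto simp: J_def)
  have sM: "sets (ghs_measure r \<theta>) = sets borel" by (simp add: ghs_measure_def)
  have sJ: "sets (Pi\<^sub>M {..<N} ?M) = sets (config_space N)"
    using sets_nu_GHS by (simp add: nu_GHS_def)
  have g': "g \<in> borel_measurable (Pi\<^sub>M {..<N} ?M)"
    using g by (subst measurable_cong_sets[OF sJ refl])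
  have split: "(\<integral>\<^sup>+\<eta>. f \<eta> \<partial>(Pi\<^sub>M {..<N} ?M))
      = (\<integral>\<^sup>+\<omega>. (\<integral>\<^sup>+b. (\<integral>\<^sup>+a. f (fun_upd (fun_upd \<omega> y b) x a) \<partial>(ghs_measure r \<theta>)) \<partial>(ghs_measure r \<theta>)) \<partial>(Pi\<^sub>M J ?M))"
    if f: "f \<in> borel_measurable (Pi\<^sub>M {..<N} ?M)" for f :: "(nat \<Rightarrow> real) \<Rightarrow> ennreal"
  proof -
    have fin: "finite (insert y J)" using J by simp
    have f': "f \<in> borel_measurable (Pi\<^sub>M (insert x (insert y J)) ?M)" using f J(4) by simp
    note [measurable] = f'
    have m: "(\<lambda>\<omega>. \<integral>\<^sup>+a. f (fun_upd \<omega> x a) \<partial>(ghs_measure r \<theta>)) \<in> borel_measurable (Pi\<^sub>M (insert y J) ?M)"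
      by measurable
    show ?thesis
      unfolding J(4) product_nn_integral_insert[OF fin J(3) f'] product_nn_integral_insert[OF J(1,2) m] ..
  qed
  let ?F = "\<lambda>\<eta>. \<integral>\<^sup>+\<alpha>. ennreal (ghs_q r \<theta> \<alpha> (\<eta> x) (\<eta> y)) * g (transfer x y \<alpha> \<eta>) \<partial>lborel"
  have F: "?F \<in> borel_measurable (config_space N)"
  proof -
    note [measurable] = ghs_q_measurable[OF r] coordinate_measurable[OF xy(1)] coordinate_measurable[OF xy(2)]
    have [measurable]: "(\<lambda>p. g (transfer x y (snd p) (fst p))) \<in> borel_measurable (config_space N \<Otimes>\<^sub>M lborel)"
      using measurable_compose[OF transfer_measurable[OF xy(1,2)] g]
      by (simp add: case_prod_beta)
    have "(\<lambda>p. ennreal (ghs_q r \<theta> (snd p) (fst p x) (fst p y)) * g (transfer x y (snd p) (fst p)))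
        \<in> borel_measurable (config_space N \<Otimes>\<^sub>M lborel)"
      by measurable
    then show ?thesis
      using lborel.borel_measurable_nn_integral by (simp add: case_prod_beta')
  qed
  then have F': "?F \<in> borel_measurable (Pi\<^sub>M {..<N} ?M)"
    by (subst measurable_cong_sets[OF sJ refl])
  have "(\<integral>\<^sup>+\<eta>. ?F \<eta> \<partial>(Pi\<^sub>M {..<N} ?M)) = (\<integral>\<^sup>+\<eta>. g \<eta> \<partial>(Pi\<^sub>M {..<N} ?M))"
    unfolding split[OF F'] split[OF g']
  proof (rule nn_integral_cong)
    fix \<omega> assume \<omega>: "\<omega> \<in> space (Pi\<^sub>M J ?M)"
    have t: "transfer x y \<alpha> (fun_upd (fun_upd \<omega> y b) x a) = fun_upd (fun_upd \<omega> y (b + \<alpha>)) x (a - \<alpha>)" for a b \<alpha>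
      using xy(3) by (auto simp: transfer_def delta_def fun_eq_iff)
    have "(\<lambda>p. fun_upd (fun_upd \<omega> y (snd p)) x (fst p)) \<in> borel \<Otimes>\<^sub>M borel \<rightarrow>\<^sub>M Pi\<^sub>M {..<N} (\<lambda>_. borel)"
    proof (rule measurable_PiM_single')
      show "(\<lambda>p. (fun_upd (fun_upd \<omega> y (snd p)) x (fst p)) z) \<in> borel_measurable (borel \<Otimes>\<^sub>M borel)" for z
        by (cases "z = x"; cases "z = y") auto
      show "(\<lambda>p. fun_upd (fun_upd \<omega> y (snd p)) x (fst p)) \<in> space (borel \<Otimes>\<^sub>M borel) \<rightarrow> {..<N} \<rightarrow>\<^sub>E space borel"
        using \<omega> J(4) by (auto simp: space_PiM PiE_iff extensional_def)
    qed
    then have G: "(\<lambda>p. g (fun_upd (fun_upd \<omega> y (snd p)) x (fst p))) \<in> borel_measurable (borel \<Otimes>\<^sub>M borel)"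
      by (rule measurable_compose) (use g in \<open>simp add: config_space_def\<close>)
    show "(\<integral>\<^sup>+b. (\<integral>\<^sup>+a. ?F (fun_upd (fun_upd \<omega> y b) x a) \<partial>(ghs_measure r \<theta>)) \<partial>(ghs_measure r \<theta>))
        = (\<integral>\<^sup>+b. (\<integral>\<^sup>+a. g (fun_upd (fun_upd \<omega> y b) x a) \<partial>(ghs_measure r \<theta>)) \<partial>(ghs_measure r \<theta>))"
      using ghs_two_site_invariance[OF r G, of \<theta>] xy(3) by (simp add: t)
  qed
  then show ?thesis by (simp add: nu_GHS_def)
qed

text \<open>The joint law \<open>K\<close> of configuration and jump has image \<open>nu_GHS\<close>
  under the jump map, as the version for non-negative functions shows on indicators. Image measures
  extend this to integrable \<open>f\<close>, and Fubini separates the two variables.\<close>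

lemma has_bochner_integral_transfer:
  assumes r: "0 < r" and \<theta>: "\<bar>\<theta>\<bar> < pi / 2" and xy: "x < N" "y < N" "x \<noteq> y"
    and f: "integrable (nu_GHS r \<theta> N) f"
  shows "has_bochner_integral (nu_GHS r \<theta> N)
    (\<lambda>\<eta>. LINT \<alpha>|lborel. ghs_q r \<theta> \<alpha> (\<eta> x) (\<eta> y) * f (transfer x y \<alpha> \<eta>))
    (LINT \<eta>|nu_GHS r \<theta> N. f \<eta>)"
proof -
  let ?\<nu> = "nu_GHS r \<theta> N"
  interpret \<nu>: prob_space ?\<nu> by (rule prob_space_nu_GHS[OF r \<theta>])
  interpret pair_sigma_finite ?\<nu> "lborel :: real measure" ..
  define T where "T = (\<lambda>(\<eta>, \<alpha>). transfer x y \<alpha> \<eta>)"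
  define q where "q p = ghs_q r \<theta> (snd p) (fst p x) (fst p y)" for p :: "(nat \<Rightarrow> real) \<times> real"
  have sP: "sets (?\<nu> \<Otimes>\<^sub>M lborel) = sets (config_space N \<Otimes>\<^sub>M borel)"
    by (intro sets_pair_measure_cong sets_nu_GHS) simp
  have T[measurable]: "T \<in> ?\<nu> \<Otimes>\<^sub>M lborel \<rightarrow>\<^sub>M ?\<nu>"
    unfolding T_def using transfer_measurable[OF xy(1,2)]
    by (subst measurable_cong_sets[OF sP sets_nu_GHS])
  have "q \<in> borel_measurable (config_space N \<Otimes>\<^sub>M borel)"
    unfolding q_def[abs_def] using xy
    by (intro ghs_q_measurable[OF r] measurable_compose[OF measurable_fst] coordinate_measurable) auto
  then have q[measurable]: "q \<in> borel_measurable (?\<nu> \<Otimes>\<^sub>M lborel)"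
    by (subst measurable_cong_sets[OF sP refl])
  have q0: "0 \<le> q p" for p unfolding q_def by (rule ghs_q_nonneg[OF r])
  define K where "K = density (?\<nu> \<Otimes>\<^sub>M lborel) (\<lambda>p. ennreal (q p))"
  have TK: "T \<in> K \<rightarrow>\<^sub>M ?\<nu>" unfolding K_def by simp
  have distr: "distr K ?\<nu> T = ?\<nu>"
  proof (rule measure_eqI)
    fix A assume "A \<in> sets (distr K ?\<nu> T)"
    then have A[measurable]: "A \<in> sets ?\<nu>" by simp
    have "emeasure (distr K ?\<nu> T) A = (\<integral>\<^sup>+p. indicator A (T p) \<partial>K)"
      using TK by (simp add: nn_integral_indicator[symmetric] nn_integral_distr del: nn_integral_indicator)
    also have "\<dots> = (\<integral>\<^sup>+p. ennreal (q p) * indicator A (T p) \<partial>(?\<nu> \<Otimes>\<^sub>M lborel))"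
      unfolding K_def by (subst nn_integral_density) auto
    also have "\<dots> = (\<integral>\<^sup>+\<eta>. (\<integral>\<^sup>+\<alpha>. ennreal (q (\<eta>, \<alpha>)) * indicator A (T (\<eta>, \<alpha>)) \<partial>lborel) \<partial>?\<nu>)"
      by (subst lborel.nn_integral_fst[symmetric]) auto
    also have "\<dots> = (\<integral>\<^sup>+\<eta>. indicator A \<eta> \<partial>?\<nu>)"
      unfolding q_def T_def using nn_integral_transfer[OF r \<theta> xy, of "indicator A"] A
      by (simp add: sets_nu_GHS)
    finally show "emeasure (distr K ?\<nu> T) A = emeasure ?\<nu> A" by simp
  qed simp
  have "integrable (distr K ?\<nu> T) f" unfolding distr by (rule f)
  then have "integrable K (\<lambda>p. f (T p))"
    using f TK by (subst (asm) integrable_distr_eq) auto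
  then have I: "integrable (?\<nu> \<Otimes>\<^sub>M lborel) (\<lambda>p. q p * f (T p))"
    unfolding K_def using f q0 by (subst (asm) integrable_density) auto
  have "(LINT \<eta>|?\<nu>. f \<eta>) = (LINT \<eta>|(distr K ?\<nu> T). f \<eta>)" unfolding distr ..
  also have "\<dots> = (LINT p|K. f (T p))"
    using f TK by (subst integral_distr) auto
  also have "\<dots> = (LINT p|(?\<nu> \<Otimes>\<^sub>M lborel). q p * f (T p))"
    unfolding K_def using f q0 by (subst integral_density) auto
  finally have E: "(LINT p|(?\<nu> \<Otimes>\<^sub>M lborel). q p * f (T p)) = (LINT \<eta>|?\<nu>. f \<eta>)" ..
  show ?thesis
    using integrable_fst'[OF I] integral_fst'[OF I] E
    by (simp add: has_bochner_integral_iff q_def T_def)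
qed

section \<open>Generator and semigroup under the product measure\<close>

lemma neighboursD: "(x, y) \<in> neighbours N \<Longrightarrow> x < N \<and> y < N \<and> x \<noteq> y"
  by (simp add: neighbours_def)

lemma bounded_measurableE:
  assumes "f \<in> bounded_measurable M"
  obtains B where "0 \<le> B" "\<And>x. x \<in> space M \<Longrightarrow> \<bar>f x\<bar> \<le> B"
proof -
  obtain B where "\<And>x. x \<in> space M \<Longrightarrow> \<bar>f x\<bar> \<le> B"
    using assms unfolding bounded_measurable_def bounded_iff by auto
  then show ?thesis by (intro that[of "max B 0"]) (auto simp: le_max_iff_disj)
qed

lemma bounded_measurableI:
  "f \<in> borel_measurable M \<Longrightarrow> (\<And>x. x \<in> space M \<Longrightarrow> \<bar>f x\<bar> \<le> B) \<Longrightarrow> f \<in> bounded_measurable M"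
  unfolding bounded_measurable_def bounded_iff by auto

lemma bounded_measurable_nu_GHS: "bounded_measurable (nu_GHS r \<theta> N) = bounded_measurable (config_space N)"
  unfolding bounded_measurable_def space_nu_GHS measurable_cong_sets[OF sets_nu_GHS refl] ..

text \<open>Since q integrates to 1, each ordered pair contributes P f - f for a Markov operator P
  preserving \<open>nu_GHS\<close>; hence the mean is 0 pair by pair. Each such difference is at
  most 2 B in modulus, and the prefactor 1/2 leaves \<open>B\<close> per ordered pair.\<close>

lemma L_Red_bounded_measurable:
  assumes r: "0 < r" and \<theta>: "\<bar>\<theta>\<bar> < pi / 2"
    and f: "f \<in> bounded_measurable (nu_GHS r \<theta> N)"
    and B: "\<And>\<eta>. \<eta> \<in> space (nu_GHS r \<theta> N) \<Longrightarrow> \<bar>f \<eta>\<bar> \<le> B"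
  shows "has_bochner_integral (nu_GHS r \<theta> N) (L_Red r \<theta> N f) 0"
    and "\<And>\<eta>. \<eta> \<in> space (nu_GHS r \<theta> N) \<Longrightarrow> \<bar>L_Red r \<theta> N f \<eta>\<bar> \<le> real (card (neighbours N)) * B"
    and "L_Red r \<theta> N f \<in> bounded_measurable (nu_GHS r \<theta> N)"
proof -
  let ?\<nu> = "nu_GHS r \<theta> N"
  interpret \<nu>: prob_space ?\<nu> by (rule prob_space_nu_GHS[OF r \<theta>])
  let ?P = "\<lambda>x y \<eta>. LINT \<alpha>|lborel. ghs_q r \<theta> \<alpha> (\<eta> x) (\<eta> y) * f (transfer x y \<alpha> \<eta>)"
  have fm: "f \<in> borel_measurable ?\<nu>" using f by (simp add: bounded_measurable_def)
  then have fc: "f \<in> borel_measurable (config_space N)"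
    by (simp add: measurable_cong_sets[OF sets_nu_GHS refl])
  have fi: "integrable ?\<nu> f"
    by (rule \<nu>.integrable_const_bound[where B = B]) (use B fm in auto)
  have q1: "integrable lborel (\<lambda>\<alpha>. ghs_q r \<theta> \<alpha> a b)" "(LINT \<alpha>|lborel. ghs_q r \<theta> \<alpha> a b) = 1" for a b
    using ghs_q_moments(1)[OF r] by (simp_all add: has_bochner_integral_iff)
  have bq: "norm (ghs_q r \<theta> \<alpha> (\<eta> x) (\<eta> y) * f (transfer x y \<alpha> \<eta>)) \<le> B * ghs_q r \<theta> \<alpha> (\<eta> x) (\<eta> y)"
    if "\<eta> \<in> space ?\<nu>" "x < N" "y < N" for \<eta> x y \<alpha>
    using B[of "transfer x y \<alpha> \<eta>"] transfer_in_space[OF that(2,3)] that(1) ghs_q_nonneg[OF r]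
    by (simp add: space_nu_GHS abs_mult mult.commute[of "ghs_q _ _ _ _ _"] mult_right_mono)
  have qf: "integrable lborel (\<lambda>\<alpha>. ghs_q r \<theta> \<alpha> (\<eta> x) (\<eta> y) * f (transfer x y \<alpha> \<eta>))"
    if \<eta>: "\<eta> \<in> space ?\<nu>" and xy: "x < N" "y < N" for \<eta> x y
  proof (rule Bochner_Integration.integrable_bound)
    show "integrable lborel (\<lambda>\<alpha>. B * ghs_q r \<theta> \<alpha> (\<eta> x) (\<eta> y))"
      by (intro integrable_mult_right q1)
    have "(\<lambda>\<alpha>. (\<eta>, \<alpha>)) \<in> borel \<rightarrow>\<^sub>M config_space N \<Otimes>\<^sub>M borel"
      using \<eta> by (intro measurable_Pair1') (simp add: space_nu_GHS)
    from measurable_compose[OF measurable_compose[OF this transfer_measurable[OF xy]] fc]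
    have "(\<lambda>\<alpha>. f (transfer x y \<alpha> \<eta>)) \<in> borel_measurable borel" by simp
    then show "(\<lambda>\<alpha>. ghs_q r \<theta> \<alpha> (\<eta> x) (\<eta> y) * f (transfer x y \<alpha> \<eta>)) \<in> borel_measurable lborel"
      by (intro borel_measurable_times ghs_q_measurable[OF r]) auto
    show "AE \<alpha> in lborel. norm (ghs_q r \<theta> \<alpha> (\<eta> x) (\<eta> y) * f (transfer x y \<alpha> \<eta>))
        \<le> norm (B * ghs_q r \<theta> \<alpha> (\<eta> x) (\<eta> y))"
      by (intro AE_I2 order_trans[OF bq[OF \<eta> xy]]) simp
  qed
  have L: "L_Red r \<theta> N f \<eta> = 1 / 2 * (\<Sum>(x, y)\<in>neighbours N. ?P x y \<eta> - f \<eta>)"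
    if \<eta>: "\<eta> \<in> space ?\<nu>" for \<eta>
  proof -
    have "(LINT \<alpha>|lborel. ghs_q r \<theta> \<alpha> (\<eta> x) (\<eta> y) * (f (transfer x y \<alpha> \<eta>) - f \<eta>)) = ?P x y \<eta> - f \<eta>"
      if "(x, y) \<in> neighbours N" for x y
      using qf[OF \<eta>, of x y] q1 neighboursD[OF that] by (simp add: right_diff_distrib)
    then show ?thesis unfolding L_Red_def by (intro arg_cong[where f = "(*) (1 / 2)"] sum.cong) auto
  qed
  have "has_bochner_integral ?\<nu> (\<lambda>\<eta>. 1 / 2 * (\<Sum>p\<in>neighbours N. ?P (fst p) (snd p) \<eta> - f \<eta>))
    (1 / 2 * (\<Sum>p\<in>neighbours N. (LINT \<eta>|?\<nu>. f \<eta>) - (LINT \<eta>|?\<nu>. f \<eta>)))"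
  proof (intro has_bochner_integral_mult_right has_bochner_integral_sum has_bochner_integral_diff)
    fix p assume "p \<in> neighbours N"
    then show "has_bochner_integral ?\<nu> (?P (fst p) (snd p)) (LINT \<eta>|?\<nu>. f \<eta>)"
      using neighboursD[of "fst p" "snd p" N]
      by (intro has_bochner_integral_transfer[OF r \<theta> _ _ _ fi]) auto
  qed (use fi in \<open>simp add: has_bochner_integral_iff\<close>)
  then show int: "has_bochner_integral ?\<nu> (L_Red r \<theta> N f) 0"
    by (subst has_bochner_integral_cong[OF refl _ refl, of _ _ "\<lambda>\<eta>. 1 / 2 * (\<Sum>p\<in>neighbours N. ?P (fst p) (snd p) \<eta> - f \<eta>)"])
       (simp_all add: L case_prod_beta')
  show bound: "\<bar>L_Red r \<theta> N f \<eta>\<bar> \<le> real (card (neighbours N)) * B" if \<eta>: "\<eta> \<in> space ?\<nu>" for \<eta>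
  proof -
    have "\<bar>?P x y \<eta> - f \<eta>\<bar> \<le> 2 * B" if "(x, y) \<in> neighbours N" for x y
    proof -
      have xy: "x < N" "y < N" using neighboursD[OF that] by auto
      have "\<bar>?P x y \<eta>\<bar> \<le> (LINT \<alpha>|lborel. B * ghs_q r \<theta> \<alpha> (\<eta> x) (\<eta> y))"
        using Bochner_Integration.integral_norm_bound_integral[OF qf[OF \<eta> xy] integrable_mult_right[OF q1(1)] bq[OF \<eta> xy]] by simp
      also have "\<dots> = B" using q1 by simp
      finally show ?thesis using B[OF \<eta>] by linarith
    qed
    then have "\<bar>\<Sum>(x, y)\<in>neighbours N. ?P x y \<eta> - f \<eta>\<bar> \<le> (\<Sum>p\<in>neighbours N. 2 * B)"
      by (intro order_trans[OF sum_abs] sum_mono) auto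
    then show ?thesis unfolding L[OF \<eta>] by (simp add: abs_mult)
  qed
  show "L_Red r \<theta> N f \<in> bounded_measurable ?\<nu>"
    using int bound by (intro bounded_measurableI) (auto simp: has_bochner_integral_iff)
qed

text \<open>Geometric growth of the iterates provides the majorant for the exponential
  series.\<close>

lemma L_Red_power_bounded:
  assumes r: "0 < r" and \<theta>: "\<bar>\<theta>\<bar> < pi / 2"
    and f: "f \<in> bounded_measurable (nu_GHS r \<theta> N)"
    and B: "\<And>\<eta>. \<eta> \<in> space (nu_GHS r \<theta> N) \<Longrightarrow> \<bar>f \<eta>\<bar> \<le> B"
  shows "(L_Red r \<theta> N ^^ k) f \<in> bounded_measurable (nu_GHS r \<theta> N) \<and>
    (\<forall>\<eta>\<in>space (nu_GHS r \<theta> N). \<bar>(L_Red r \<theta> N ^^ k) f \<eta>\<bar> \<le> real (card (neighbours N)) ^ k * B)"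
proof (induction k)
  case (Suc k)
  then show ?case
    using L_Red_bounded_measurable(2,3)[OF r \<theta>, of "(L_Red r \<theta> N ^^ k) f" N "real (card (neighbours N)) ^ k * B"]
    by (auto simp: mult.assoc)
qed (use f B in auto)

text \<open>Every term of the exponential series with k \<ge> 1 is a multiple of the generator
  applied to a bounded measurable function and has mean 0, so only \<open>f\<close> remains. Sum and
  integral may be exchanged by the majorant B (t n)^k / k!.\<close>

lemma nu_GHS_invariant:
  assumes r: "0 < r" and \<theta>: "\<bar>\<theta>\<bar> < pi / 2"
  shows "invariant_measure (L_Red r \<theta> N) (nu_GHS r \<theta> N)"
  unfolding invariant_measure_def
proof (intro conjI allI impI ballI)
  let ?\<nu> = "nu_GHS r \<theta> N"
  show "prob_space ?\<nu>" by (rule prob_space_nu_GHS[OF r \<theta>])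
  then interpret \<nu>: prob_space ?\<nu> .
  fix t :: real and f
  assume t: "0 \<le> t" and f: "f \<in> bounded_measurable ?\<nu>"
  obtain B where B: "0 \<le> B" "\<And>\<eta>. \<eta> \<in> space ?\<nu> \<Longrightarrow> \<bar>f \<eta>\<bar> \<le> B"
    using bounded_measurableE[OF f] by blast
  define n where "n = real (card (neighbours N))"
  define g where "g k \<eta> = t ^ k / fact k * (L_Red r \<theta> N ^^ k) f \<eta>" for k \<eta>
  note P = L_Red_power_bounded[OF r \<theta> f B(2), folded n_def]
  have gb: "\<bar>g k \<eta>\<bar> \<le> B * ((t * n) ^ k /\<^sub>R fact k)" if "\<eta> \<in> space ?\<nu>" for k \<eta>
  proof -
    have "\<bar>g k \<eta>\<bar> = t ^ k / fact k * \<bar>(L_Red r \<theta> N ^^ k) f \<eta>\<bar>"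
      using t by (simp add: g_def abs_mult)
    also have "\<dots> \<le> t ^ k / fact k * (n ^ k * B)"
      using P[of k] that t by (intro mult_left_mono) auto
    finally show ?thesis by (simp add: power_mult_distrib field_simps)
  qed
  have sm: "summable (\<lambda>k. B * ((t * n) ^ k /\<^sub>R fact k))"
    by (intro summable_mult summable_exp_generic)
  have meas: "g k \<in> borel_measurable ?\<nu>" for k
    using P[of k] unfolding g_def[abs_def] bounded_measurable_def by auto
  have gi: "integrable ?\<nu> (g k)" for k
    by (rule \<nu>.integrable_const_bound[where B = "B * ((t * n) ^ k /\<^sub>R fact k)"]) (use gb meas in auto)
  have s1: "AE \<eta> in ?\<nu>. summable (\<lambda>k. norm (g k \<eta>))"
    using gb by (intro AE_I2 summable_comparison_test'[OF sm]) auto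
  have s2: "summable (\<lambda>k. LINT \<eta>|?\<nu>. norm (g k \<eta>))"
  proof (rule summable_comparison_test'[OF sm])
    fix k
    have "(LINT \<eta>|?\<nu>. norm (g k \<eta>)) \<le> B * ((t * n) ^ k /\<^sub>R fact k)"
      using gb by (intro \<nu>.integral_le_const integrable_norm gi AE_I2) auto
    moreover have "0 \<le> (LINT \<eta>|?\<nu>. norm (g k \<eta>))" by (intro Bochner_Integration.integral_nonneg) auto
    ultimately show "norm (LINT \<eta>|?\<nu>. norm (g k \<eta>)) \<le> B * ((t * n) ^ k /\<^sub>R fact k)" by simp
  qed
  have e: "exp_semigroup (L_Red r \<theta> N) t f = (\<lambda>\<eta>. \<Sum>k. g k \<eta>)"
    by (simp add: exp_semigroup_def g_def fun_eq_iff)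
  show "integrable ?\<nu> (exp_semigroup (L_Red r \<theta> N) t f)"
    unfolding e by (rule integrable_suminf[OF gi s1 s2])
  have z: "(LINT \<eta>|?\<nu>. g (Suc k) \<eta>) = 0" for k
    using L_Red_bounded_measurable(1)[OF r \<theta>, of "(L_Red r \<theta> N ^^ k) f" N "n ^ k * B"] P[of k]
    by (simp add: g_def has_bochner_integral_iff)
  have "(LINT \<eta>|?\<nu>. exp_semigroup (L_Red r \<theta> N) t f \<eta>) = (\<Sum>k. LINT \<eta>|?\<nu>. g k \<eta>)"
    unfolding e by (rule integral_suminf[OF gi s1 s2])
  also have "\<dots> = (\<Sum>k\<in>{0}. LINT \<eta>|?\<nu>. g k \<eta>)"
  proof (rule suminf_finite)
    show "(LINT \<eta>|?\<nu>. g k \<eta>) = 0" if "k \<notin> {0}" for k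
      using that z[of "k - 1"] by (cases k) auto
  qed simp
  also have "\<dots> = (LINT \<eta>|?\<nu>. f \<eta>)" by (simp add: g_def)
  finally show "(LINT \<eta>|?\<nu>. exp_semigroup (L_Red r \<theta> N) t f \<eta>) = (LINT \<eta>|?\<nu>. f \<eta>)" .
qed

section \<open>Action on polynomials\<close>

lemma polynomial_deg_le_monomial:
  assumes "m \<in> {..<N} \<rightarrow>\<^sub>E {..d}" "(\<Sum>z<N. m z) \<le> d"
  shows "polynomial_deg_le N d (\<lambda>\<eta>. \<Prod>z<N. \<eta> z ^ m z)"
proof -
  let ?S = "{m. m \<in> {..<N} \<rightarrow>\<^sub>E {..d} \<and> (\<Sum>z<N. m z) \<le> d}"
  have fin: "finite ?S"
    by (rule finite_subset[of _ "{..<N} \<rightarrow>\<^sub>E {..d}"]) (auto intro: finite_PiE)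
  have "(\<Prod>z<N. \<eta> z ^ m z) = (\<Sum>m'\<in>?S. (if m' = m then 1 else 0) * (\<Prod>z<N. \<eta> z ^ m' z))"
    for \<eta> :: "nat \<Rightarrow> real"
  proof -
    have "(\<Sum>m'\<in>?S. (if m' = m then 1 else 0) * (\<Prod>z<N. \<eta> z ^ m' z))
        = (\<Sum>m'\<in>?S. if m' = m then \<Prod>z<N. \<eta> z ^ m' z else 0)"
      by (intro sum.cong) auto
    then show ?thesis using assms fin by (simp add: sum.delta)
  qed
  then show ?thesis unfolding polynomial_deg_le_def by (intro exI[of _ "\<lambda>m'. if m' = m then 1 else 0"]) blast
qed

lemma polynomial_deg_le_add:
  assumes "polynomial_deg_le N d f" "polynomial_deg_le N d g"
  shows "polynomial_deg_le N d (\<lambda>\<eta>. f \<eta> + g \<eta>)"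
proof -
  obtain a b where "\<forall>\<eta>\<in>space (config_space N). f \<eta> = (\<Sum>m | m \<in> {..<N} \<rightarrow>\<^sub>E {..d} \<and> (\<Sum>z<N. m z) \<le> d. a m * (\<Prod>z<N. \<eta> z ^ m z))"
    "\<forall>\<eta>\<in>space (config_space N). g \<eta> = (\<Sum>m | m \<in> {..<N} \<rightarrow>\<^sub>E {..d} \<and> (\<Sum>z<N. m z) \<le> d. b m * (\<Prod>z<N. \<eta> z ^ m z))"
    using assms unfolding polynomial_deg_le_def by blast
  then show ?thesis unfolding polynomial_deg_le_def
    by (intro exI[of _ "\<lambda>m. a m + b m"]) (simp add: distrib_right sum.distrib)
qed

lemma polynomial_deg_le_cmult:
  assumes "polynomial_deg_le N d f"
  shows "polynomial_deg_le N d (\<lambda>\<eta>. k * f \<eta>)"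
proof -
  obtain a where "\<forall>\<eta>\<in>space (config_space N). f \<eta> = (\<Sum>m | m \<in> {..<N} \<rightarrow>\<^sub>E {..d} \<and> (\<Sum>z<N. m z) \<le> d. a m * (\<Prod>z<N. \<eta> z ^ m z))"
    using assms unfolding polynomial_deg_le_def by blast
  then show ?thesis unfolding polynomial_deg_le_def
    by (intro exI[of _ "\<lambda>m. k * a m"]) (simp add: sum_distrib_left mult.assoc)
qed

lemma polynomial_deg_le_const: "polynomial_deg_le N d (\<lambda>\<eta>. k)"
proof -
  have "polynomial_deg_le N d (\<lambda>\<eta>. \<Prod>z<N. \<eta> z ^ (\<lambda>z\<in>{..<N}. 0) z)"
    by (rule polynomial_deg_le_monomial) (auto split: if_splits)
  from polynomial_deg_le_cmult[OF this, of k] show ?thesis by simp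
qed

lemma polynomial_deg_le_diff:
  assumes "polynomial_deg_le N d f" "polynomial_deg_le N d g"
  shows "polynomial_deg_le N d (\<lambda>\<eta>. f \<eta> - g \<eta>)"
  using polynomial_deg_le_add[OF assms(1) polynomial_deg_le_cmult[OF assms(2), of "-1"]] by simp

lemma polynomial_deg_le_sum:
  assumes "\<And>i. i \<in> I \<Longrightarrow> polynomial_deg_le N d (f i)"
  shows "polynomial_deg_le N d (\<lambda>\<eta>. \<Sum>i\<in>I. f i \<eta>)"
  using assms
  by (induction I rule: infinite_finite_induct) (auto intro: polynomial_deg_le_const polynomial_deg_le_add)

lemma polynomial_deg_le_var:
  assumes "x < N" "1 \<le> d"
  shows "polynomial_deg_le N d (\<lambda>\<eta>. \<eta> x)"
proof -
  let ?m = "\<lambda>z\<in>{..<N}. if z = x then 1 else 0 :: nat"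
  have "polynomial_deg_le N d (\<lambda>\<eta>. \<Prod>z<N. \<eta> z ^ ?m z)"
    using assms by (intro polynomial_deg_le_monomial) (auto simp: sum.delta split: if_splits)
  moreover have "(\<Prod>z<N. \<eta> z ^ ?m z) = \<eta> x" for \<eta> :: "nat \<Rightarrow> real"
  proof -
    have "(\<Prod>z<N. \<eta> z ^ ?m z) = (\<Prod>z<N. if z = x then \<eta> z else 1)" by (intro prod.cong) auto
    then show ?thesis using assms by (simp add: prod.delta)
  qed
  ultimately show ?thesis by simp
qed

lemma polynomial_deg_le_var_mult:
  assumes "x < N" "y < N" "2 \<le> d"
  shows "polynomial_deg_le N d (\<lambda>\<eta>. \<eta> x * \<eta> y)"
proof -
  \<comment> \<open>The indicators are added rather than merged, so that x = y yields the exponent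
    2.\<close>
  let ?m = "\<lambda>z\<in>{..<N}. (if z = x then 1 else 0) + (if z = y then 1 else 0 :: nat)"
  have "(\<Sum>z<N. ?m z) = (\<Sum>z<N. if z = x then 1 else 0) + (\<Sum>z<N. if z = y then 1 else 0)"
    unfolding sum.distrib[symmetric] by (intro sum.cong) auto
  then have "polynomial_deg_le N d (\<lambda>\<eta>. \<Prod>z<N. \<eta> z ^ ?m z)"
    using assms by (intro polynomial_deg_le_monomial) (auto simp: sum.delta split: if_splits)
  moreover have "(\<Prod>z<N. \<eta> z ^ ?m z) = \<eta> x * \<eta> y" for \<eta> :: "nat \<Rightarrow> real"
  proof -
    have "(\<Prod>z<N. \<eta> z ^ ?m z) = (\<Prod>z<N. (if z = x then \<eta> z else 1) * (if z = y then \<eta> z else 1))"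
      by (intro prod.cong) auto
    then show ?thesis using assms by (simp add: prod.delta prod.distrib)
  qed
  ultimately show ?thesis by simp
qed

lemmas polynomial_deg_le_intros =
  polynomial_deg_le_add polynomial_deg_le_diff polynomial_deg_le_sum polynomial_deg_le_cmult
  polynomial_deg_le_const polynomial_deg_le_var polynomial_deg_le_var_mult

text \<open>The second moment of the jump size under q at the states a and b, as computed in
  \<open>ghs_q_moments\<close>.\<close>

definition jump_second_moment :: "real \<Rightarrow> real \<Rightarrow> real \<Rightarrow> real" where
  "jump_second_moment r a b = (a - b)\<^sup>2 / 4 + (r\<^sup>2 + (a + b)\<^sup>2 / 4) / (2 * r + 1)"

text \<open>A jump changes a polynomial of degree two by a quadratic in \<alpha> without constant
  term, so only the first two moments of q enter. The coefficient \<open>C\<close> is free of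
  \<eta>; when \<open>A\<close> has degree one, its product with the linear mean jump stays
  quadratic, so the degree does not grow.\<close>

lemma L_Red_quadratic_increment:
  assumes r: "0 < r"
    and inc: "\<And>u v \<alpha> \<eta>. (u, v) \<in> neighbours N \<Longrightarrow>
      f (transfer u v \<alpha> \<eta>) - f \<eta> = A u v \<eta> * \<alpha> + C u v * \<alpha>\<^sup>2"
  shows "L_Red_defined r \<theta> N f"
    and "L_Red r \<theta> N f = (\<lambda>\<eta>. 1 / 2 * (\<Sum>(u, v)\<in>neighbours N.
      A u v \<eta> * ((\<eta> u - \<eta> v) / 2) + C u v * jump_second_moment r (\<eta> u) (\<eta> v)))"
proof -
  have *: "has_bochner_integral lborel
      (\<lambda>\<alpha>. ghs_q r \<theta> \<alpha> (\<eta> u) (\<eta> v) * (f (transfer u v \<alpha> \<eta>) - f \<eta>))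
      (A u v \<eta> * ((\<eta> u - \<eta> v) / 2) + C u v * jump_second_moment r (\<eta> u) (\<eta> v))"
    if "(u, v) \<in> neighbours N" for u v \<eta>
  proof -
    have "has_bochner_integral lborel
      (\<lambda>\<alpha>. A u v \<eta> * (\<alpha> * ghs_q r \<theta> \<alpha> (\<eta> u) (\<eta> v)) + C u v * (\<alpha>\<^sup>2 * ghs_q r \<theta> \<alpha> (\<eta> u) (\<eta> v)))
      (A u v \<eta> * ((\<eta> u - \<eta> v) / 2) + C u v * jump_second_moment r (\<eta> u) (\<eta> v))"
      unfolding jump_second_moment_def
      by (intro has_bochner_integral_add has_bochner_integral_mult_right ghs_q_moments[OF r])
    then show ?thesis unfolding inc[OF that] by (simp add: algebra_simps)
  qed
  show "L_Red_defined r \<theta> N f"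
    unfolding L_Red_defined_def using * by (auto simp: has_bochner_integral_iff)
  show "L_Red r \<theta> N f = (\<lambda>\<eta>. 1 / 2 * (\<Sum>(u, v)\<in>neighbours N.
      A u v \<eta> * ((\<eta> u - \<eta> v) / 2) + C u v * jump_second_moment r (\<eta> u) (\<eta> v)))"
  proof
    fix \<eta>
    show "L_Red r \<theta> N f \<eta> = 1 / 2 * (\<Sum>(u, v)\<in>neighbours N.
      A u v \<eta> * ((\<eta> u - \<eta> v) / 2) + C u v * jump_second_moment r (\<eta> u) (\<eta> v))"
      unfolding L_Red_def
      by (intro arg_cong[where f = "(*) (1 / 2)"] sum.cong refl)
         (use * in \<open>auto simp: has_bochner_integral_iff\<close>)
  qed
qed

lemma polynomial_deg_le_neighbours:
  assumes "\<And>u v. u < N \<Longrightarrow> v < N \<Longrightarrow> polynomial_deg_le N d (h u v)"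
  shows "polynomial_deg_le N d (\<lambda>\<eta>. 1 / 2 * (\<Sum>(u, v)\<in>neighbours N. h u v \<eta>))"
proof -
  have "polynomial_deg_le N d (\<lambda>\<eta>. 1 / 2 * (\<Sum>p\<in>neighbours N. h (fst p) (snd p) \<eta>))"
    by (intro polynomial_deg_le_cmult polynomial_deg_le_sum assms)
       (auto simp: neighbours_def)
  then show ?thesis by (simp add: case_prod_beta')
qed

lemma L_Red_coordinate:
  assumes r: "0 < r" and x: "x < N"
  shows "L_Red_defined r \<theta> N (\<lambda>\<eta>. \<eta> x)"
    and "polynomial_deg_le N 1 (L_Red r \<theta> N (\<lambda>\<eta>. \<eta> x))"
proof -
  have inc: "transfer u v \<alpha> \<eta> x - \<eta> x = (delta v x - delta u x) * \<alpha> + 0 * \<alpha>\<^sup>2" for u v \<alpha> \<eta>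
    by (simp add: transfer_def algebra_simps)
  note L = L_Red_quadratic_increment[OF r, of N "\<lambda>\<eta>. \<eta> x" "\<lambda>u v \<eta>. delta v x - delta u x" "\<lambda>u v. 0", OF inc]
  show "L_Red_defined r \<theta> N (\<lambda>\<eta>. \<eta> x)" by (rule L(1))
  have "polynomial_deg_le N 1 (\<lambda>\<eta>. (delta v x - delta u x) / 2 * (\<eta> u - \<eta> v))" if "u < N" "v < N" for u v
    using that by (intro polynomial_deg_le_intros) auto
  then show "polynomial_deg_le N 1 (L_Red r \<theta> N (\<lambda>\<eta>. \<eta> x))"
    unfolding L(2) by (intro polynomial_deg_le_neighbours) simp
qed

lemma polynomial_deg_le_jump_second_moment:
  assumes "u < N" "v < N"
  shows "polynomial_deg_le N 2 (\<lambda>\<eta>. jump_second_moment r (\<eta> u) (\<eta> v))"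
proof -
  define i where "i = 1 / (2 * r + 1)"
  have e: "jump_second_moment r a b = (1 + i) / 4 * (a * a + b * b) + (i - 1) / 2 * (a * b) + r\<^sup>2 * i" for a b
  proof -
    have "jump_second_moment r a b = (a - b)\<^sup>2 / 4 + (r\<^sup>2 + (a + b)\<^sup>2 / 4) * i"
      by (simp add: jump_second_moment_def i_def)
    also have "\<dots> = (1 + i) / 4 * (a * a + b * b) + (i - 1) / 2 * (a * b) + r\<^sup>2 * i"
      by (simp add: power2_eq_square field_simps)
    finally show ?thesis .
  qed
  show ?thesis unfolding e using assms by (intro polynomial_deg_le_intros) auto
qed

text \<open>The two sites are arbitrary and may coincide, which covers the torus with a single site,
  where the successor of x is x itself.\<close>

lemma L_Red_coordinate_product:
  assumes r: "0 < r" and x: "x < N" "y < N"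
  shows "L_Red_defined r \<theta> N (\<lambda>\<eta>. \<eta> x * \<eta> y)"
    and "polynomial_deg_le N 2 (L_Red r \<theta> N (\<lambda>\<eta>. \<eta> x * \<eta> y))"
proof -
  define e where "e u v z = delta v z - delta u z" for u v z
  have inc: "transfer u v \<alpha> \<eta> x * transfer u v \<alpha> \<eta> y - \<eta> x * \<eta> y
      = (e u v x * \<eta> y + e u v y * \<eta> x) * \<alpha> + (e u v x * e u v y) * \<alpha>\<^sup>2" for u v \<alpha> \<eta>
    by (simp add: transfer_def e_def algebra_simps power2_eq_square)
  note L = L_Red_quadratic_increment[OF r, of N "\<lambda>\<eta>. \<eta> x * \<eta> y" "\<lambda>u v \<eta>. e u v x * \<eta> y + e u v y * \<eta> x"
      "\<lambda>u v. e u v x * e u v y", OF inc]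
  show "L_Red_defined r \<theta> N (\<lambda>\<eta>. \<eta> x * \<eta> y)" by (rule L(1))
  have "polynomial_deg_le N 2 (\<lambda>\<eta>. (e u v x * \<eta> y + e u v y * \<eta> x) * ((\<eta> u - \<eta> v) / 2)
      + e u v x * e u v y * jump_second_moment r (\<eta> u) (\<eta> v))" if uv: "u < N" "v < N" for u v
  proof -
    have *: "(e u v x * \<eta> y + e u v y * \<eta> x) * ((\<eta> u - \<eta> v) / 2)
        = e u v x / 2 * (\<eta> y * \<eta> u - \<eta> y * \<eta> v) + e u v y / 2 * (\<eta> x * \<eta> u - \<eta> x * \<eta> v)" for \<eta>
      by (simp add: field_simps)
    show ?thesis unfolding *
      using uv x by (intro polynomial_deg_le_intros polynomial_deg_le_jump_second_moment) auto
  qed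
  then show "polynomial_deg_le N 2 (L_Red r \<theta> N (\<lambda>\<eta>. \<eta> x * \<eta> y))"
    unfolding L(2) by (intro polynomial_deg_le_neighbours)
qed

theorem mainTheorem3:
  fixes r \<rho> \<theta> :: real and N :: nat
  assumes "r > 0" and "\<theta> = arctan (\<rho> / r)" and "N \<ge> 1"
  shows
    "(\<forall>x y. has_bochner_integral lborel (\<lambda>\<alpha>. ghs_q r \<theta> \<alpha> x y) 1) \<and>
     (\<forall>x y \<alpha>. ghs_q r \<theta> \<alpha> x y * ghs_density r \<theta> x * ghs_density r \<theta> y =
        ghs_q r \<theta> \<alpha> (y + \<alpha>) (x - \<alpha>) * ghs_density r \<theta> (x - \<alpha>) * ghs_density r \<theta> (y + \<alpha>)) \<and>
     prob_space (ghs_measure r \<theta>) \<and>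
     integrable (ghs_measure r \<theta>) (\<lambda>\<eta>. \<eta>) \<and>
     integrable (ghs_measure r \<theta>) (\<lambda>\<eta>. \<eta>\<^sup>2) \<and>
     prob_space.expectation (ghs_measure r \<theta>) (\<lambda>\<eta>. \<eta>) = \<rho> \<and>
     prob_space.variance (ghs_measure r \<theta>) (\<lambda>\<eta>. \<eta>) = \<rho>\<^sup>2 / r + r \<and>
     invariant_measure (L_Red r \<theta> N) (nu_GHS r \<theta> N) \<and>
     (\<forall>f\<in>bounded_measurable (config_space N).
        has_bochner_integral (nu_GHS r \<theta> N) (L_Red r \<theta> N f) 0) \<and>
     (\<forall>x y. has_bochner_integral lborel (\<lambda>\<alpha>. \<alpha> * ghs_q r \<theta> \<alpha> x y) ((x - y) / 2)) \<and>
     (\<exists>a b c d e k :: real. (a \<noteq> 0 \<or> b \<noteq> 0 \<or> c \<noteq> 0) \<and>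
        (\<forall>x y. has_bochner_integral lborel (\<lambda>\<alpha>. \<alpha>\<^sup>2 * ghs_q r \<theta> \<alpha> x y)
           (a * x\<^sup>2 + b * x * y + c * y\<^sup>2 + d * x + e * y + k))) \<and>
     (\<forall>x<N. L_Red_defined r \<theta> N (\<lambda>\<eta>. \<eta> x) \<and>
        polynomial_deg_le N 1 (L_Red r \<theta> N (\<lambda>\<eta>. \<eta> x))) \<and>
     (\<forall>x<N. L_Red_defined r \<theta> N (\<lambda>\<eta>. \<eta> x * \<eta> ((x + 1) mod N)) \<and>
        polynomial_deg_le N 2 (L_Red r \<theta> N (\<lambda>\<eta>. \<eta> x * \<eta> ((x + 1) mod N))))"
proof -
  note r = assms(1)
  \<comment> \<open>The range of the arctangent is exactly the range of tilts that the decay of the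
    weight allows.\<close>
  have \<theta>: "\<bar>\<theta>\<bar> < pi / 2"
    using arctan_bounded[of "\<rho> / r"] unfolding assms(2) by linarith
  have tan: "r * tan \<theta> = \<rho>" using r by (simp add: assms(2) tan_arctan)
  interpret prob_space "ghs_measure r \<theta>" by (rule prob_space_ghs_measure[OF r \<theta>])
  note m = ghs_measure_moments[OF r \<theta>]
  have i1: "integrable (ghs_measure r \<theta>) (\<lambda>\<eta>. \<eta>)" and i2: "integrable (ghs_measure r \<theta>) (\<lambda>\<eta>. \<eta>\<^sup>2)"
    and E: "expectation (\<lambda>\<eta>. \<eta>) = \<rho>"
    using m tan by (simp_all add: has_bochner_integral_iff)
  have "variance (\<lambda>\<eta>. \<eta>) = r + r * (r + 1) * (tan \<theta>)\<^sup>2 - \<rho>\<^sup>2"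
    using variance_eq[OF i1 i2] m(2) E by (simp add: has_bochner_integral_iff)
  also have "tan \<theta> = \<rho> / r" by (simp add: assms(2) tan_arctan)
  also have "r + r * (r + 1) * (\<rho> / r)\<^sup>2 - \<rho>\<^sup>2 = \<rho>\<^sup>2 / r + r"
    using r by (simp add: field_simps power2_eq_square)
  finally have V: "variance (\<lambda>\<eta>. \<eta>) = \<rho>\<^sup>2 / r + r" .
  have bal: "ghs_q r \<theta> \<alpha> x y * ghs_density r \<theta> x * ghs_density r \<theta> y =
        ghs_q r \<theta> \<alpha> (y + \<alpha>) (x - \<alpha>) * ghs_density r \<theta> (x - \<alpha>) * ghs_density r \<theta> (y + \<alpha>)" for x y \<alpha>
    by (rule ghs_detailed_balance)
  have L0: "has_bochner_integral (nu_GHS r \<theta> N) (L_Red r \<theta> N f) 0"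
    if f: "f \<in> bounded_measurable (config_space N)" for f
  proof -
    obtain B where "\<And>\<eta>. \<eta> \<in> space (config_space N) \<Longrightarrow> \<bar>f \<eta>\<bar> \<le> B"
      using bounded_measurableE[OF f] by blast
    then show ?thesis
      using f by (intro L_Red_bounded_measurable(1)[OF r \<theta>, of f N B])
        (simp_all add: bounded_measurable_nu_GHS space_nu_GHS)
  qed
  have q2: "\<exists>a b c d e k :: real. (a \<noteq> 0 \<or> b \<noteq> 0 \<or> c \<noteq> 0) \<and>
        (\<forall>x y. has_bochner_integral lborel (\<lambda>\<alpha>. \<alpha>\<^sup>2 * ghs_q r \<theta> \<alpha> x y)
           (a * x\<^sup>2 + b * x * y + c * y\<^sup>2 + d * x + e * y + k))"
  proof (intro exI conjI allI)
    \<comment> \<open>With this abbreviation the second moment expands with leading coefficients (1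
      + i)/4, (i - 1)/2 and (1 + i)/4; the first is positive, so the degree is exactly two.\<close>
    define i where "i = 1 / (2 * r + 1)"
    have "0 < i" using r by (simp add: i_def)
    then show "(1 + i) / 4 \<noteq> 0 \<or> (i - 1) / 2 \<noteq> 0 \<or> (1 + i) / 4 \<noteq> 0" by simp
    fix x y
    have "(x - y)\<^sup>2 / 4 + (r\<^sup>2 + (x + y)\<^sup>2 / 4) * i
        = (1 + i) / 4 * x\<^sup>2 + (i - 1) / 2 * x * y + (1 + i) / 4 * y\<^sup>2 + 0 * x + 0 * y + r\<^sup>2 * i"
      by (simp add: power2_eq_square field_simps)
    then show "has_bochner_integral lborel (\<lambda>\<alpha>. \<alpha>\<^sup>2 * ghs_q r \<theta> \<alpha> x y)
        ((1 + i) / 4 * x\<^sup>2 + (i - 1) / 2 * x * y + (1 + i) / 4 * y\<^sup>2 + 0 * x + 0 * y + r\<^sup>2 * i)"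
      using ghs_q_moments(3)[OF r, of \<theta> x y] by (simp add: i_def)
  qed
  have N: "(x + 1) mod N < N" for x using assms(3) by simp
  show ?thesis
    by (intro conjI allI impI ballI)
      (rule ghs_q_moments(1)[OF r] bal prob_space_axioms i1 i2 E V nu_GHS_invariant[OF r \<theta>]
        ghs_q_moments(2)[OF r] q2 | erule L0 L_Red_coordinate[OF r] L_Red_coordinate_product[OF r _ N])+
qed

end
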